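(* Let $A\in\mathbb{R}^{m\times n}$ be nonzero, let $\theta>0$, let $1\le M\le m$ and $1\le N\le n$, and let $0<\epsilon<1/2$. Partition $A$ (and every other $m\times n$ matrix below) into blocks $\begin{pmatrix} A_{11} & A_{12} \\ A_{21} & A_{22} \end{pmatrix}$ with $A_{11}\in\mathbb{R}^{M\times N}$, and let $E_{M\times N}$ be the $M\times N$ all-ones matrix. Let $(\lambda^*,u_1^*,v_1^* )\in\mathbb{R}\times\mathbb{R}^M\times\mathbb{R}^N$, with $u_1^*\ge 0$ and $v_1^*\ge 0$ entrywise, be a solution of the system $$(\lambda A_{11}-\theta E_{M\times N})v_1-u_1=0,\qquad (\lambda A_{11}-\theta E_{M\times N})^Tu_1-v_1=0,\qquad u_1^Tu_1-1=0,$$ in the unknowns $(\lambda,u_1,v_1)$. Let $(\lambda,u_1,v_1)\in\mathbb{R}\times\mathbb{R}^M\times\mathbb{R}^N$ be an $\epsilon$-solution of this system corresponding to $(\lambda^*,u_1^*,v_1^* )$, i.e. $\|(\lambda,u_1,v_1)-(\lambda^*,u_1^*,v_1^* )\|\le\epsilon$. Suppose there exist $W,V\in\mathbb{R}^{m\times n}$ such that: (i) $W_{11}=(\lambda A_{11}-\theta V_{11})-u_1v_1^T$ and $V_{11}=E_{M\times N}$; (ii) $W_{12}=\lambda A_{12}-\theta V_{12}$, $W_{12}^Tu_1=0$, and $\|V_{12}\|_\infty\le 1-\theta^{-1}(\|A_{12}\|_\infty+5)\epsilon$; (iii) $W_{21}=\lambda A_{21}-\theta V_{21}$, $W_{21}v_1=0$,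 and $\|V_{21}\|_\infty\le 1-\theta^{-1}(\|A_{21}\|_\infty+5)\epsilon$; (iv) $W_{22}=\lambda A_{22}-\theta V_{22}$ and $\|V_{22}\|_\infty\le 1$; (v) $\|W\|_2\le 1-(\|A\|_2+7.5)\epsilon$. Then $(\lambda^*,u_1^*,v_1^* )$ defines a rank-one optimal solution of the problem $$\min_{X\in\mathbb{R}^{m\times n}}\ \|X\|_*+\theta\|X\|_1\quad\text{subject to}\quad \langle A,X\rangle=1;$$ that is, there is a scalar $\sigma_1^*$ (determined by the constraint $\langle A,X^*\rangle=1$) such that $$X^*=\begin{pmatrix} \sigma_1^*\,u_1^*(v_1^* )^T & 0 \\ 0 & 0 \end{pmatrix}$$ is an optimal solution of this problem.
   Context: $\|X\|_*$ is the nuclear norm (sum of singular values); $\|X\|_1$ is the sum of the absolute values of all entries of $X$; $\|X\|_\infty$ is the maximum absolute value of the entries of $X$ (the dual norm of $\|\cdot\|_1$); $\|X\|_2$ is the spectral norm (largest singular value); $\langle A,X\rangle=\sum_{i,j}A_{ij}X_{ij}$; $\|\cdot\|$ on $\mathbb{R}\times\mathbb{R}^M\times\mathbb{R}^N\cong\mathbb{R}^{1+M+N}$ is the Euclidean norm. If $M=m$ or $N=n$, the corresponding blocks are empty and conditions on them are vacuous. *)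

theory Defs
  imports
    Complex_Main
    "HOL-Library.Multiset"
    "HOL-Computational_Algebra.Polynomial"
    "Jordan_Normal_Form.Matrix"
    "Jordan_Normal_Form.Char_Poly"
    "Jordan_Normal_Form.DL_Rank"
begin

(* Square roots of the eigenvalues of X^T X, counted with algebraic multiplicity. X^T X is real
   symmetric and positive semidefinite, so all its eigenvalues are nonnegative reals. The multiset
   has dim_col X elements: compared with the convention of listing min (dim_row X) (dim_col X)
   singular values it may contain additional zeros, which affect neither the sum nor (for matrices
   with at least one row and one column) the maximum. *)
definition singular_values :: "real mat \<Rightarrow> real multiset" where
  "singular_values X = image_mset sqrt (proots (char_poly (transpose_mat X * X)))"

definition nuclear_norm :: "real mat \<Rightarrow> real" where
  "nuclear_norm X = sum_mset (singular_values X)"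

(* Meaningful only for matrices with at least one column (Max of the empty set is unspecified). *)
definition spectral_norm :: "real mat \<Rightarrow> real" where
  "spectral_norm X = Max (set_mset (singular_values X))"

definition entry_sum_norm :: "real mat \<Rightarrow> real" where
  "entry_sum_norm X = (\<Sum>i<dim_row X. \<Sum>j<dim_col X. \<bar>X $$ (i, j)\<bar>)"

(* Meaningful only for matrices with at least one entry (Max of the empty set is unspecified). *)
definition entry_max_norm :: "real mat \<Rightarrow> real" where
  "entry_max_norm X = Max (abs ` elements_mat X)"

definition mat_inner :: "real mat \<Rightarrow> real mat \<Rightarrow> real" where
  "mat_inner A X = (\<Sum>i<dim_row A. \<Sum>j<dim_col A. A $$ (i, j) * X $$ (i, j))"

definition ones_mat :: "nat \<Rightarrow> nat \<Rightarrow> real mat" where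
  "ones_mat M N = mat M N (\<lambda>_. 1)"

definition outer_prod :: "real vec \<Rightarrow> real vec \<Rightarrow> real mat" where
  "outer_prod u v = mat (dim_vec u) (dim_vec v) (\<lambda>(i, j). u $ i * v $ j)"

(* The Euclidean norm on R x R^M x R^N. *)
definition triple_norm :: "real \<Rightarrow> real vec \<Rightarrow> real vec \<Rightarrow> real" where
  "triple_norm l u v = sqrt (l\<^sup>2 + u \<bullet> u + v \<bullet> v)"

definition solves_system ::
  "nat \<Rightarrow> nat \<Rightarrow> real mat \<Rightarrow> real \<Rightarrow> real \<Rightarrow> real vec \<Rightarrow> real vec \<Rightarrow> bool" where
  "solves_system M N A11 \<theta> l u v \<longleftrightarrow>
     u \<in> carrier_vec M \<and> v \<in> carrier_vec N \<and>
     (l \<cdot>\<^sub>m A11 - \<theta> \<cdot>\<^sub>m ones_mat M N) *\<^sub>v v - u = 0\<^sub>v M \<and>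
     transpose_mat (l \<cdot>\<^sub>m A11 - \<theta> \<cdot>\<^sub>m ones_mat M N) *\<^sub>v u - v = 0\<^sub>v N \<and>
     u \<bullet> u - 1 = 0"

definition eps_solution ::
  "nat \<Rightarrow> nat \<Rightarrow> real \<Rightarrow> real \<Rightarrow> real vec \<Rightarrow> real vec \<Rightarrow> real \<Rightarrow> real vec \<Rightarrow> real vec \<Rightarrow> bool" where
  "eps_solution M N \<epsilon> ls us vs l u v \<longleftrightarrow>
     u \<in> carrier_vec M \<and> v \<in> carrier_vec N \<and>
     triple_norm (l - ls) (u - us) (v - vs) \<le> \<epsilon>"

definition objective :: "real \<Rightarrow> real mat \<Rightarrow> real" where
  "objective \<theta> X = nuclear_norm X + \<theta> * entry_sum_norm X"

definition feasible :: "real mat \<Rightarrow> real mat \<Rightarrow> bool" where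
  "feasible A X \<longleftrightarrow> X \<in> carrier_mat (dim_row A) (dim_col A) \<and> mat_inner A X = 1"

definition optimal_solution :: "real mat \<Rightarrow> real \<Rightarrow> real mat \<Rightarrow> bool" where
  "optimal_solution A \<theta> X \<longleftrightarrow>
     feasible A X \<and> (\<forall>Y. feasible A Y \<longrightarrow> objective \<theta> X \<le> objective \<theta> Y)"

definition rank_one_block :: "nat \<Rightarrow> nat \<Rightarrow> real \<Rightarrow> real vec \<Rightarrow> real vec \<Rightarrow> real mat" where
  "rank_one_block m n s u v =
     (let M = dim_vec u; N = dim_vec v in
      four_block_mat (s \<cdot>\<^sub>m outer_prod u v) (0\<^sub>m M (n - N))
                     (0\<^sub>m (m - M) N)         (0\<^sub>m (m - M) (n - N)))"

end

theory Submission
  imports Defs "Jordan_Normal_Form.Spectral_Radius" "HOL-Analysis.L2_Norm"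
begin

text \<open>
  Optimality is certified by a dual pair: if \<open>ls A = Z + \<theta> U\<close> where \<open>Z\<close> is a contraction and
  all entries of \<open>U\<close> are at most 1 in absolute value, then every feasible point has objective value
  at least \<open>\<bar>ls\<bar>\<close>, because the nuclear norm is dual to the spectral norm and the entry sum norm is
  dual to the entry maximum norm. Since \<open>ls us\<^sup>T A11 vs = 1 + \<theta> (\<Sum> us) (\<Sum> vs) > 0\<close>, the scalar
  \<open>\<sigma> = 1 / us\<^sup>T A11 vs\<close> exists and \<open>X\<^sup>*\<close> attains this bound, whatever the sign of \<open>ls\<close>.

  The exact certificate is obtained from the approximate one \<open>(W, V)\<close>: the first block of \<open>U\<close> is all
  ones, \<open>V22\<close> is kept, and the off-diagonal blocks of \<open>W\<close> are projected, \<open>W12\<close> onto the orthogonal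
  complement of \<open>us\<close> and \<open>W21\<close> onto that of \<open>vs\<close>. The matrix \<open>B = ls A11 - \<theta> E\<close> maps \<open>vs\<close> to \<open>us\<close>
  and \<open>B\<^sup>T\<close> maps \<open>us\<close> to \<open>vs\<close>. So, splitting off the components of \<open>x1\<close> and \<open>y1\<close> along \<open>us\<close> and
  \<open>vs\<close>, the bilinear form of \<open>Z\<close> becomes a product of two numbers plus the form of \<open>W\<close>, up to an
  error \<open>\<epsilon> \<parallel>A\<parallel> + \<epsilon>\<^sup>2\<close>, on the orthogonal complements.
\<close>

section \<open>Spectral theorem for real symmetric matrices\<close>

text \<open>An eigenvalue exists over the complex numbers. Symmetry of a real matrix forces it to be
  real, so it is a root of the real characteristic polynomial and has a real eigenvector.\<close>

lemma symmetric_mat_has_eigenvector: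
  fixes S :: "real mat"
  assumes S: "S \<in> carrier_mat n n" and sym: "transpose_mat S = S" and n: "0 < n"
  shows "\<exists>v e. v \<in> carrier_vec n \<and> v \<bullet> v = 1 \<and> S *\<^sub>v v = e \<cdot>\<^sub>v v"
proof -
  define C where "C = map_mat complex_of_real S"
  have C: "C \<in> carrier_mat n n" using S by (simp add: C_def)
  have symC: "transpose_mat C = C" using sym by (simp add: C_def map_mat_transpose)
  have "spectrum C \<noteq> {}" using spectrum_non_empty[OF C] n by blast
  then obtain a where "eigenvalue C a" by (auto simp: spectrum_def)
  then obtain x where x: "x \<in> carrier_vec n" "x \<noteq> 0\<^sub>v n" "C *\<^sub>v x = a \<cdot>\<^sub>v x"
    using C by (auto simp: eigenvalue_def eigenvector_def)
  have conj: "C *\<^sub>v conjugate x = conjugate (C *\<^sub>v x)"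
  proof (rule eq_vecI)
    fix i assume "i < dim_vec (conjugate (C *\<^sub>v x))"
    hence i: "i < n" using C by simp
    show "(C *\<^sub>v conjugate x) $ i = conjugate (C *\<^sub>v x) $ i"
      using i C x(1) S by (auto simp: scalar_prod_def C_def)
  qed (use C in simp)
  \<comment> \<open>\<open>C\<close> is moved across the Hermitian product; being real and
    symmetric, it acts on the conjugated factor with eigenvalue \<open>cnj a\<close>.\<close>
  have "a * (x \<bullet>c x) = (C *\<^sub>v x) \<bullet>c x" using x by simp
  also have "\<dots> = x \<bullet> (C *\<^sub>v conjugate x)"
    using transpose_vec_mult_scalar[OF C, of "conjugate x" x] x(1) symC by simp
  also have "\<dots> = cnj a * (x \<bullet>c x)" using x conj by (simp add: conjugate_smult_vec)
  finally have "a = cnj a" using x by (simp add: conjugate_square_eq_0_vec)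
  hence a: "a = of_real (Re a)" by (simp add: complex_eq_iff)
  have "poly (char_poly C) a = 0"
    using \<open>eigenvalue C a\<close> eigenvalue_root_char_poly[OF C] by simp
  moreover have "char_poly C = map_poly of_real (char_poly S)"
    unfolding C_def by (rule of_real_hom.char_poly_hom[OF S])
  ultimately have "poly (char_poly S) (Re a) = 0"
    using a by (metis of_real_hom.poly_map_poly of_real_eq_0_iff)
  hence "eigenvalue S (Re a)" using eigenvalue_root_char_poly[OF S] by simp
  then obtain y where y: "y \<in> carrier_vec n" "y \<noteq> 0\<^sub>v n" "S *\<^sub>v y = Re a \<cdot>\<^sub>v y"
    using S by (auto simp: eigenvalue_def eigenvector_def)
  \<comment> \<open>On real vectors \<open>conjugate\<close> is the identity, so definiteness of the
    Hermitian product carries over.\<close>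
  have "y \<bullet> y \<noteq> 0"
  proof -
    have "conjugate y = y" by (rule eq_vecI) auto
    thus ?thesis using conjugate_square_eq_0_vec[OF y(1)] y(2) by simp
  qed
  moreover have "y \<bullet> y \<ge> 0" by (simp add: scalar_prod_def sum_nonneg)
  ultimately have pos: "y \<bullet> y > 0" by simp
  define v where "v = inverse (sqrt (y \<bullet> y)) \<cdot>\<^sub>v y"
  have "v \<bullet> v = 1" using pos y by (simp add: v_def field_simps)
  moreover have "S *\<^sub>v v = Re a \<cdot>\<^sub>v v"
    using y S by (simp add: v_def mult_mat_vec smult_smult_assoc mult.commute)
  ultimately show ?thesis using y by (intro exI[of _ v] exI[of _ "Re a"]) (simp add: v_def)
qed

text \<open>The reflection along \<open>v - unit_vec n 0\<close> swaps the two unit vectors. Being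
  symmetric and an involution it is orthogonal, which makes it the change of basis for deflating an
  eigenvector \<open>v\<close>.\<close>

lemma householder:
  fixes v :: "real vec"
  assumes v: "v \<in> carrier_vec n" and unit: "v \<bullet> v = 1" and n: "0 < n"
  shows "\<exists>H \<in> carrier_mat n n. transpose_mat H = H \<and> H * H = 1\<^sub>m n \<and> H *\<^sub>v unit_vec n 0 = v"
proof (cases "v $ 0 = 1")
  case True
  have "v = unit_vec n 0"
  proof (rule eq_vecI)
    fix i assume "i < dim_vec (unit_vec n 0)"
    hence i: "i < n" by simp
    have "(\<Sum>j<n. (v $ j)\<^sup>2) = 1" using unit v by (simp add: scalar_prod_def power2_eq_square atLeast0LessThan)
    hence "(\<Sum>j\<in>{..<n}-{0}. (v $ j)\<^sup>2) = 0" using n True by (simp add: sum.remove[of _ 0])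
    hence "i \<noteq> 0 \<Longrightarrow> v $ i = 0" using i by (subst (asm) sum_nonneg_eq_0_iff) auto
    thus "v $ i = unit_vec n 0 $ i" using True i by (cases "i = 0") auto
  qed (use v in simp)
  thus ?thesis by (intro bexI[of _ "1\<^sub>m n"]) auto
next
  case False
  define w where "w i = v $ i - (if i = 0 then 1 else 0)" for i
  \<comment> \<open>The squared length of \<open>w\<close> is \<open>2 * (1 - v $ 0)\<close>, so
    \<open>k\<close> is 2 divided by it and \<open>H\<close> is the usual reflection. In the
    excluded case \<open>v $ 0 = 1\<close> the vector \<open>w\<close> vanishes.\<close>
  define k where "k = 1 / (1 - v $ 0)"
  define H where "H = mat n n (\<lambda>(i, j). (if i = j then 1 else 0) - k * w i * w j)"
  have "(\<Sum>j<n. (v $ j)\<^sup>2) = 1"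
    using unit v by (simp add: scalar_prod_def power2_eq_square atLeast0LessThan)
  moreover have "(\<Sum>j<n. (w j)\<^sup>2) = (\<Sum>j<n. (v $ j)\<^sup>2 + (if j = 0 then 1 - 2 * v $ 0 else 0))"
    by (rule sum.cong) (auto simp: w_def power2_eq_square algebra_simps)
  ultimately have ww: "(\<Sum>j<n. w j * w j) = 2 * (1 - v $ 0)"
    using n by (simp add: sum.distrib power2_eq_square)
  hence kw: "k * (\<Sum>j<n. w j * w j) = 2" using False by (simp add: k_def field_simps)
  have H: "H \<in> carrier_mat n n" by (simp add: H_def)
  moreover have "transpose_mat H = H" by (rule eq_matI) (auto simp: H_def)
  moreover have "H * H = 1\<^sub>m n"
  proof (rule eq_matI)
    fix i j assume "i < dim_row (1\<^sub>m n :: real mat)" "j < dim_col (1\<^sub>m n :: real mat)"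
    hence ij: "i < n" "j < n" by auto
    have "(H * H) $$ (i, j) = (\<Sum>l<n. ((if i = l then 1 else 0) - k * w i * w l) * ((if l = j then 1 else 0) - k * w l * w j))"
      using ij H by (simp add: scalar_prod_def atLeast0LessThan) (simp add: H_def)
    also have "\<dots> = (\<Sum>l<n. (if l = i then if i = j then 1 else 0 else 0) - (if l = i then k * w i * w j else 0)
        - (if l = j then k * w i * w j else 0) + k * w i * w j * k * (w l * w l))"
      by (rule sum.cong) (auto simp: algebra_simps)
    also have "\<dots> = (if i = j then 1 else 0) - 2 * (k * w i * w j) + k * w i * w j * (k * (\<Sum>l<n. w l * w l))"
      using ij by (simp add: sum.distrib sum_subtractf sum_distrib_left mult.assoc)
    also have "\<dots> = 1\<^sub>m n $$ (i, j)" using ij by (simp add: kw)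
    finally show "(H * H) $$ (i, j) = 1\<^sub>m n $$ (i, j)" .
  qed (use H in auto)
  moreover have "H *\<^sub>v unit_vec n 0 = v"
  proof (rule eq_vecI)
    fix i assume "i < dim_vec v"
    hence i: "i < n" using v by simp
    \<comment> \<open>With this value, column 0 of \<open>H\<close> is the first unit vector plus
      \<open>w\<close>, that is, \<open>v\<close>.\<close>
    have "k * w 0 = -1" using False by (simp add: k_def w_def field_simps)
    hence "H $$ (i, 0) = v $ i" using i n
      by (simp add: H_def) (simp add: w_def mult.assoc mult.commute[of k] mult.left_commute[of k])
    thus "(H *\<^sub>v unit_vec n 0) $ i = v $ i" using i H n by simp
  qed (use H v in auto)
  ultimately show ?thesis by blast
qed

text \<open>Deflation by induction on the dimension: a reflection moves an eigenvector to the first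
  unit vector, symmetry clears the first row along with the first column, and the induction
  hypothesis diagonalizes the remaining block.\<close>

lemma real_spectral_theorem:
  fixes S :: "real mat"
  assumes "S \<in> carrier_mat n n" and "transpose_mat S = S"
  shows "\<exists>Q \<in> carrier_mat n n. \<exists>D \<in> carrier_mat n n.
    Q * transpose_mat Q = 1\<^sub>m n \<and> diagonal_mat D \<and> S = Q * D * transpose_mat Q"
  using assms
proof (induction n arbitrary: S)
  case 0
  show ?case
    by (intro bexI[of _ "1\<^sub>m 0"] bexI[of _ S] conjI eq_matI)
       (use 0 in \<open>auto simp: diagonal_mat_def\<close>)
next
  case (Suc k)
  note S = Suc.prems(1) and sym = Suc.prems(2)
  obtain v e where v: "v \<in> carrier_vec (Suc k)" "v \<bullet> v = 1" "S *\<^sub>v v = e \<cdot>\<^sub>v v"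
    using symmetric_mat_has_eigenvector[OF S sym] by auto
  obtain H where H: "H \<in> carrier_mat (Suc k) (Suc k)" "transpose_mat H = H" "H * H = 1\<^sub>m (Suc k)"
    and He: "H *\<^sub>v unit_vec (Suc k) 0 = v"
    using householder[OF v(1,2)] by auto
  define T where "T = H * (S * H)"
  have T: "T \<in> carrier_mat (Suc k) (Suc k)" using H S by (simp add: T_def)
  have symT: "transpose_mat T = T"
    using H S sym by (simp add: T_def transpose_mult[of _ "Suc k" "Suc k" _ "Suc k"])
  \<comment> \<open>The involution \<open>H\<close> also carries \<open>v\<close> back, so the first
    unit vector is an eigenvector of \<open>T\<close>.\<close>
  have "H *\<^sub>v v = unit_vec (Suc k) 0"
    unfolding He[symmetric] using H(1,3) by (metis assoc_mult_mat_vec one_mult_mat_vec unit_vec_carrier)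
  hence "T *\<^sub>v unit_vec (Suc k) 0 = e \<cdot>\<^sub>v unit_vec (Suc k) 0"
    using H S v He by (simp add: T_def assoc_mult_mat_vec[of _ "Suc k" "Suc k" _ "Suc k"] mult_mat_vec)
  hence T0: "T $$ (i, 0) = (if i = 0 then e else 0)" if "i < Suc k" for i
    using that T by (metis (no_types, lifting) carrier_matD index_mult_mat_vec index_row(1) index_smult_vec(1)
      index_unit_vec(1) index_unit_vec(3) mult.right_neutral mult_zero_right row_carrier scalar_prod_right_unit zero_less_Suc)
  have T0': "T $$ (0, i) = (if i = 0 then e else 0)" if "i < Suc k" for i
    using T0[OF that] symT T that by (metis carrier_matD index_transpose_mat(1) zero_less_Suc)
  define E where "E = mat 1 1 (\<lambda>_. e)"
  define R where "R = mat k k (\<lambda>(i, j). T $$ (Suc i, Suc j))"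
  have E: "E \<in> carrier_mat 1 1" and R: "R \<in> carrier_mat k k" by (auto simp: E_def R_def)
  have block: "T = four_block_mat E (0\<^sub>m 1 k) (0\<^sub>m k 1) R"
    by (rule eq_matI) (use T T0 T0' in \<open>auto simp: E_def R_def less_Suc_eq_0_disj\<close>)
  have "transpose_mat R = R"
  proof (rule eq_matI)
    fix i j assume "i < dim_row R" "j < dim_col R"
    moreover from this R T have "transpose_mat T $$ (Suc i, Suc j) = T $$ (Suc j, Suc i)" by simp
    ultimately show "transpose_mat R $$ (i, j) = R $$ (i, j)" using symT by (simp add: R_def)
  qed (use R in auto)
  from Suc.IH[OF R this] obtain Q D where Q: "Q \<in> carrier_mat k k" "Q * transpose_mat Q = 1\<^sub>m k"
    and D: "D \<in> carrier_mat k k" "diagonal_mat D" and RQ: "R = Q * D * transpose_mat Q" by blast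
  define G where "G = four_block_mat (1\<^sub>m 1) (0\<^sub>m 1 k) (0\<^sub>m k 1) Q"
  define L where "L = four_block_mat E (0\<^sub>m 1 k) (0\<^sub>m k 1) D"
  have G: "G \<in> carrier_mat (Suc k) (Suc k)" and L: "L \<in> carrier_mat (Suc k) (Suc k)"
    using Q D E by (auto simp: G_def L_def)
  have Gt: "transpose_mat G = four_block_mat (1\<^sub>m 1) (0\<^sub>m 1 k) (0\<^sub>m k 1) (transpose_mat Q)"
    unfolding G_def using Q by (subst transpose_four_block_mat[of _ 1 1 _ k _ k]) auto
  have GG: "G * transpose_mat G = 1\<^sub>m (Suc k)"
    unfolding Gt unfolding G_def using Q
    by (subst mult_four_block_mat[of _ 1 1 _ k _ k _ _ 1 _ k]) auto
  have "G * L = four_block_mat E (0\<^sub>m 1 k) (0\<^sub>m k 1) (Q * D)"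
    unfolding G_def L_def using Q D E
    by (subst mult_four_block_mat[of _ 1 1 _ k _ k _ _ 1 _ k]) auto
  hence "G * L * transpose_mat G = four_block_mat E (0\<^sub>m 1 k) (0\<^sub>m k 1) (Q * D * transpose_mat Q)"
    unfolding Gt using Q D E
    by (simp only:) (subst mult_four_block_mat[of _ 1 1 _ k _ k _ _ 1 _ k], auto)
  hence TG: "T = G * L * transpose_mat G" using block RQ by simp
  have "diagonal_mat L"
    unfolding diagonal_mat_def
  proof (intro allI impI)
    fix i j assume "i < dim_row L" "j < dim_col L" "i \<noteq> j"
    thus "L $$ (i, j) = 0" using D E by (auto simp: L_def diagonal_mat_def)
  qed
  moreover have "H * G * transpose_mat (H * G) = 1\<^sub>m (Suc k)"
  proof -
    have "H * G * transpose_mat (H * G) = H * (G * transpose_mat G) * H"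
      using H G by (simp add: transpose_mult[of _ "Suc k" "Suc k" _ "Suc k"] assoc_mult_mat[of _ "Suc k" "Suc k" _ "Suc k" _ "Suc k"])
    thus ?thesis using H by (simp add: GG)
  qed
  moreover have "S = H * G * L * transpose_mat (H * G)"
  proof -
    have HH: "H * (H * Y) = Y" if "Y \<in> carrier_mat (Suc k) (Suc k)" for Y
      using assoc_mult_mat[OF H(1) H(1) that] by (simp only: left_mult_one_mat[OF that] H(3))
    have "S = H * T * H"
      using S H by (simp add: T_def HH assoc_mult_mat[of _ "Suc k" "Suc k" _ "Suc k" _ "Suc k"])
    also have "\<dots> = H * G * L * transpose_mat (H * G)"
      using H G L by (simp add: TG transpose_mult[of _ "Suc k" "Suc k" _ "Suc k"] assoc_mult_mat[of _ "Suc k" "Suc k" _ "Suc k" _ "Suc k"])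
    finally show ?thesis .
  qed
  ultimately show ?case using H G L by (intro bexI[of _ "H * G"] bexI[of _ L]) auto
qed

section \<open>Singular values and matrix norms\<close>

definition vec_norm :: "real vec \<Rightarrow> real" where
  "vec_norm x = sqrt (x \<bullet> x)"

text \<open>An orthonormal eigenbasis of X^T X stands in for a full singular value decomposition.
  Left singular vectors, which would require division by possibly zero singular values, are avoided:
  singular values appear as lengths of the images \<open>X *\<^sub>v w i\<close>, with zeros and
  multiplicities.\<close>

locale right_singular_basis =
  fixes X :: "real mat" and m n :: nat and w :: "nat \<Rightarrow> real vec"
  assumes X: "X \<in> carrier_mat m n"
    and w: "i < n \<Longrightarrow> w i \<in> carrier_vec n"
    and orth: "i < n \<Longrightarrow> j < n \<Longrightarrow> w i \<bullet> w j = (if i = j then 1 else 0)"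
    and parseval: "x \<in> carrier_vec n \<Longrightarrow> y \<in> carrier_vec n \<Longrightarrow>
      x \<bullet> y = (\<Sum>i<n. (w i \<bullet> x) * (w i \<bullet> y))"
    and eig: "i < n \<Longrightarrow>
      transpose_mat X *\<^sub>v (X *\<^sub>v w i) = ((X *\<^sub>v w i) \<bullet> (X *\<^sub>v w i)) \<cdot>\<^sub>v w i"
    and sv: "singular_values X = image_mset (\<lambda>i. vec_norm (X *\<^sub>v w i)) (mset_set {..<n})"

text \<open>The basis consists of the columns of an orthogonal matrix \<open>Q\<close> diagonalizing
  X^T X: Q^T Q = 1 gives orthonormality, Q Q^T = 1 gives Parseval.\<close>

lemma ex_right_singular_basis:
  assumes X: "X \<in> carrier_mat m n"
  shows "\<exists>w. right_singular_basis X m n w"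
proof -
  define S where "S = transpose_mat X * X"
  have S: "S \<in> carrier_mat n n" using X by (simp add: S_def)
  have "transpose_mat S = S" using X by (simp add: S_def transpose_mult[of _ n m])
  from real_spectral_theorem[OF S this] obtain Q D where Q: "Q \<in> carrier_mat n n"
    and D: "D \<in> carrier_mat n n" "diagonal_mat D" and QQ: "Q * transpose_mat Q = 1\<^sub>m n"
    and SQ: "S = Q * D * transpose_mat Q" by blast
  have Qt: "transpose_mat Q \<in> carrier_mat n n" using Q by simp
  have QQ': "transpose_mat Q * Q = 1\<^sub>m n" by (rule mat_mult_left_right_inverse[OF Q Qt QQ])
  define w where "w i = col Q i" for i
  have w: "w i \<in> carrier_vec n" for i using Q by (intro carrier_vecI) (simp add: w_def)
  have orth: "w i \<bullet> w j = (if i = j then 1 else 0)" if "i < n" "j < n" for i j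
  proof -
    have "(transpose_mat Q * Q) $$ (i, j) = w i \<bullet> w j" using that Q by (simp add: w_def)
    thus ?thesis using that by (simp add: QQ')
  qed
  have parseval: "x \<bullet> y = (\<Sum>i<n. (w i \<bullet> x) * (w i \<bullet> y))" if "x \<in> carrier_vec n" "y \<in> carrier_vec n" for x y
  proof -
    have "x \<bullet> y = x \<bullet> (Q *\<^sub>v (transpose_mat Q *\<^sub>v y))"
      using that Q by (simp add: assoc_mult_mat_vec[symmetric, OF Q Qt] QQ)
    also have "\<dots> = (transpose_mat Q *\<^sub>v x) \<bullet> (transpose_mat Q *\<^sub>v y)"
      using that Q by (intro transpose_vec_mult_scalar[symmetric, of _ n n]) auto
    also have "\<dots> = (\<Sum>i<n. (w i \<bullet> x) * (w i \<bullet> y))"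
      using that Q by (simp add: scalar_prod_def[of "transpose_mat Q *\<^sub>v x"] w_def atLeast0LessThan)
    finally show ?thesis .
  qed
  have eig: "S *\<^sub>v w i = D $$ (i, i) \<cdot>\<^sub>v w i" if i: "i < n" for i
  proof -
    have "S * Q = Q * D" using Q Qt D by (simp add: SQ assoc_mult_mat[of _ n n _ n _ n] QQ')
    hence "S *\<^sub>v w i = Q *\<^sub>v col D i"
      using i Q S D by (metis carrier_matD(2) col_mult2 w_def)
    also have "\<dots> = D $$ (i, i) \<cdot>\<^sub>v w i"
    proof (rule eq_vecI)
      fix j assume "j < dim_vec (D $$ (i, i) \<cdot>\<^sub>v w i)"
      hence j: "j < n" using Q by (simp add: w_def)
      have "(Q *\<^sub>v col D i) $ j = (\<Sum>l<n. Q $$ (j, l) * D $$ (l, i))"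
        using i j Q D by (simp add: scalar_prod_def atLeast0LessThan)
      also have "\<dots> = (\<Sum>l<n. if l = i then Q $$ (j, i) * D $$ (i, i) else 0)"
        using D i by (intro sum.cong) (auto simp: diagonal_mat_def)
      also have "\<dots> = (D $$ (i, i) \<cdot>\<^sub>v w i) $ j" using i j Q by (simp add: w_def)
      finally show "(Q *\<^sub>v col D i) $ j = (D $$ (i, i) \<cdot>\<^sub>v w i) $ j" .
    qed (use Q in \<open>simp add: w_def\<close>)
    finally show ?thesis .
  qed
  have SX: "S *\<^sub>v w i = transpose_mat X *\<^sub>v (X *\<^sub>v w i)" for i
    unfolding S_def by (rule assoc_mult_mat_vec[of _ n m _ n]) (use X w in auto)
  \<comment> \<open>Eigenvalues of X^T X are identified as squared lengths; their square roots are
    then the lengths required by \<open>sv\<close>.\<close>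
  have val: "(X *\<^sub>v w i) \<bullet> (X *\<^sub>v w i) = D $$ (i, i)" if "i < n" for i
  proof -
    have "(X *\<^sub>v w i) \<bullet> (X *\<^sub>v w i) = (transpose_mat X *\<^sub>v (X *\<^sub>v w i)) \<bullet> w i"
      using X w by (intro transpose_vec_mult_scalar[symmetric, of _ m n]) auto
    thus ?thesis using eig[OF that] orth[OF that that] w by (simp add: SX[symmetric])
  qed
  \<comment> \<open>Similarity to \<open>D\<close> splits the characteristic polynomial into linear
    factors, so its roots with multiplicity are the diagonal entries of \<open>D\<close>.\<close>
  have "similar_mat S D"
    using Q Qt D S QQ QQ' SQ by (intro similar_matI[of _ _ Q "transpose_mat Q" n]) auto
  hence "char_poly S = char_poly D" by (rule char_poly_similar)
  also have "\<dots> = (\<Prod>a\<leftarrow>diag_mat D. [:- a, 1:])"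
    using D by (intro char_poly_upper_triangular[of _ n]) (auto simp: diagonal_mat_def upper_triangular_def)
  finally have "char_poly S = (\<Prod>a\<leftarrow>diag_mat D. [:- a, 1:])" .
  moreover have "proots (\<Prod>a\<leftarrow>xs. [:- a, 1:]) = mset xs" for xs :: "real list"
  proof (induction xs)
    case (Cons a xs)
    have "(\<Prod>a\<leftarrow>xs. [:- a, 1:]) \<noteq> 0" by (auto simp: prod_list_zero_iff)
    thus ?case using Cons by (simp add: proots_mult del: mult_pCons_left)
  qed simp
  ultimately have "proots (char_poly S) = mset (diag_mat D)" by simp
  also have "\<dots> = image_mset (\<lambda>i. D $$ (i, i)) (mset_set {..<n})"
    using D by (simp add: diag_mat_def flip: mset_upt atLeast0LessThan)
  finally have "singular_values X = image_mset (\<lambda>i. sqrt (D $$ (i, i))) (mset_set {..<n})"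
    by (simp add: singular_values_def S_def multiset.map_comp o_def)
  also have "\<dots> = image_mset (\<lambda>i. vec_norm (X *\<^sub>v w i)) (mset_set {..<n})"
    by (intro image_mset_cong) (simp add: vec_norm_def val)
  finally have sv: "singular_values X = image_mset (\<lambda>i. vec_norm (X *\<^sub>v w i)) (mset_set {..<n})" .
  have "transpose_mat X *\<^sub>v (X *\<^sub>v w i) = ((X *\<^sub>v w i) \<bullet> (X *\<^sub>v w i)) \<cdot>\<^sub>v w i" if "i < n" for i
    using eig[OF that] by (simp only: SX val[OF that])
  from X w orth parseval this sv show ?thesis
    by (intro exI[of _ w] right_singular_basis.intro)
qed

lemma scalar_prod_self_nonneg: "0 \<le> (x :: real vec) \<bullet> x"
  by (simp add: scalar_prod_def sum_nonneg)

lemma vec_norm_nonneg: "0 \<le> vec_norm x"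
  by (simp add: vec_norm_def scalar_prod_self_nonneg)

lemma vec_norm_sq: "(vec_norm x)\<^sup>2 = x \<bullet> x"
  by (simp add: vec_norm_def scalar_prod_self_nonneg)

lemma abs_scalar_prod_le:
  assumes "x \<in> carrier_vec n" "y \<in> carrier_vec n"
  shows "\<bar>x \<bullet> y\<bar> \<le> vec_norm x * vec_norm y"
proof -
  have "\<bar>x \<bullet> y\<bar> \<le> (\<Sum>i<n. \<bar>x $ i\<bar> * \<bar>y $ i\<bar>)"
    using assms sum_abs[of "\<lambda>i. x $ i * y $ i" "{..<n}"]
    by (simp add: scalar_prod_def atLeast0LessThan abs_mult)
  also have "\<dots> \<le> L2_set (($) x) {..<n} * L2_set (($) y) {..<n}" by (rule L2_set_mult_ineq)
  also have "\<dots> = vec_norm x * vec_norm y"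
    using assms by (simp add: L2_set_def vec_norm_def scalar_prod_def atLeast0LessThan power2_eq_square)
  finally show ?thesis .
qed

lemma vec_norm_append:
  assumes "x \<in> carrier_vec m" "y \<in> carrier_vec n"
  shows "vec_norm (x @\<^sub>v y) = sqrt ((vec_norm x)\<^sup>2 + (vec_norm y)\<^sup>2)"
  unfolding vec_norm_sq by (simp add: vec_norm_def scalar_prod_append[OF assms assms])

text \<open>In the right singular basis, the squared length of \<open>X *\<^sub>v y\<close> is the
  sum of the squared coordinates of \<open>y\<close> weighted by the squared singular values.
  \<open>0 < n\<close> keeps \<open>Max\<close> away from the empty set.\<close>

lemma vec_norm_mult_mat_vec_le:
  assumes X: "X \<in> carrier_mat m n" and y: "y \<in> carrier_vec n" and n: "0 < n"
  shows "0 \<le> spectral_norm X" and "vec_norm (X *\<^sub>v y) \<le> spectral_norm X * vec_norm y"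
proof -
  obtain w where "right_singular_basis X m n w" using ex_right_singular_basis[OF X] by blast
  then interpret right_singular_basis X m n w .
  have le: "vec_norm (X *\<^sub>v w i) \<le> spectral_norm X" if "i < n" for i
    unfolding spectral_norm_def sv using that by (intro Max_ge) auto
  show nonneg: "0 \<le> spectral_norm X" using le[OF n] vec_norm_nonneg order_trans by blast
  have Xt: "transpose_mat X *\<^sub>v (X *\<^sub>v y) \<in> carrier_vec n" using X y by auto
  have "(vec_norm (X *\<^sub>v y))\<^sup>2 = y \<bullet> (transpose_mat X *\<^sub>v (X *\<^sub>v y))"
    using X y by (simp add: vec_norm_sq comm_scalar_prod[OF y Xt] transpose_vec_mult_scalar[of X m n])
  also have "\<dots> = (\<Sum>i<n. (w i \<bullet> y) * (w i \<bullet> (transpose_mat X *\<^sub>v (X *\<^sub>v y))))"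
    by (rule parseval[OF y Xt])
  also have "\<dots> = (\<Sum>i<n. (w i \<bullet> y)\<^sup>2 * (vec_norm (X *\<^sub>v w i))\<^sup>2)"
  proof (rule sum.cong[OF refl])
    fix i assume "i \<in> {..<n}"
    hence i: "i < n" by simp
    have "w i \<bullet> (transpose_mat X *\<^sub>v (X *\<^sub>v y)) = (X *\<^sub>v y) \<bullet> (X *\<^sub>v w i)"
      using X y w[OF i] by (simp add: comm_scalar_prod[OF w[OF i] Xt] transpose_vec_mult_scalar[of X m n])
    also have "\<dots> = (transpose_mat X *\<^sub>v (X *\<^sub>v w i)) \<bullet> y"
      using X y w[OF i]
      by (simp add: comm_scalar_prod[of "X *\<^sub>v y" m] transpose_vec_mult_scalar[of X m n])
    also have "\<dots> = (vec_norm (X *\<^sub>v w i))\<^sup>2 * (w i \<bullet> y)"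
      using y w[OF i] by (simp add: eig[OF i] vec_norm_sq)
    finally show "(w i \<bullet> y) * (w i \<bullet> (transpose_mat X *\<^sub>v (X *\<^sub>v y))) = (w i \<bullet> y)\<^sup>2 * (vec_norm (X *\<^sub>v w i))\<^sup>2"
      by (simp add: power2_eq_square)
  qed
  also have "\<dots> \<le> (\<Sum>i<n. (w i \<bullet> y)\<^sup>2 * (spectral_norm X)\<^sup>2)"
    by (intro sum_mono mult_left_mono power_mono) (auto simp: le vec_norm_nonneg)
  also have "\<dots> = (spectral_norm X * vec_norm y)\<^sup>2"
    unfolding power_mult_distrib vec_norm_sq parseval[OF y y]
    by (simp add: power2_eq_square mult.commute flip: sum_distrib_left)
  finally show "vec_norm (X *\<^sub>v y) \<le> spectral_norm X * vec_norm y"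
    by (rule power2_le_imp_le) (simp add: nonneg vec_norm_nonneg)
qed

lemma abs_bilinear_le_spectral_norm:
  assumes X: "X \<in> carrier_mat m n" and x: "x \<in> carrier_vec m" and y: "y \<in> carrier_vec n" and n: "0 < n"
  shows "\<bar>x \<bullet> (X *\<^sub>v y)\<bar> \<le> spectral_norm X * (vec_norm x * vec_norm y)"
proof -
  have "\<bar>x \<bullet> (X *\<^sub>v y)\<bar> \<le> vec_norm x * vec_norm (X *\<^sub>v y)"
    using X x y by (intro abs_scalar_prod_le) auto
  also have "\<dots> \<le> vec_norm x * (spectral_norm X * vec_norm y)"
    by (intro mult_left_mono vec_norm_mult_mat_vec_le[OF X y n] vec_norm_nonneg)
  finally show ?thesis by (simp add: mult_ac)
qed

text \<open>The inner product is a trace and can be evaluated in the right singular basis of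
  \<open>Y\<close>, where each term is at most a singular value because \<open>w i\<close> is a unit
  vector. \<open>Z\<close> is constrained through its bilinear form, the shape in which the
  certificate is estimated.\<close>

lemma nuclear_norm_dual:
  assumes Z: "Z \<in> carrier_mat m n" and Y: "Y \<in> carrier_mat m n"
    and contr: "\<And>x y. x \<in> carrier_vec m \<Longrightarrow> y \<in> carrier_vec n \<Longrightarrow> \<bar>x \<bullet> (Z *\<^sub>v y)\<bar> \<le> vec_norm x * vec_norm y"
  shows "\<bar>mat_inner Z Y\<bar> \<le> nuclear_norm Y"
proof -
  obtain w where "right_singular_basis Y m n w" using ex_right_singular_basis[OF Y] by blast
  then interpret right_singular_basis Y m n w .
  have "mat_inner Z Y = (\<Sum>r<m. row Z r \<bullet> row Y r)"
    using Z Y by (simp add: mat_inner_def scalar_prod_def atLeast0LessThan)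
  also have "\<dots> = (\<Sum>r<m. \<Sum>i<n. (row Z r \<bullet> w i) * (row Y r \<bullet> w i))"
  proof (rule sum.cong[OF refl])
    fix r
    have rows: "row Z r \<in> carrier_vec n" "row Y r \<in> carrier_vec n" using Z Y by (auto intro: carrier_vecI)
    show "row Z r \<bullet> row Y r = (\<Sum>i<n. (row Z r \<bullet> w i) * (row Y r \<bullet> w i))"
      unfolding parseval[OF rows]
      by (intro sum.cong refl) (simp add: comm_scalar_prod[OF w rows(1)] comm_scalar_prod[OF w rows(2)])
  qed
  also have "\<dots> = (\<Sum>i<n. \<Sum>r<m. (row Z r \<bullet> w i) * (row Y r \<bullet> w i))" by (rule sum.swap)
  also have "\<dots> = (\<Sum>i<n. (Y *\<^sub>v w i) \<bullet> (Z *\<^sub>v w i))"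
    using Z Y by (intro sum.cong refl) (simp add: scalar_prod_def[of "Y *\<^sub>v _"] atLeast0LessThan mult.commute)
  finally have eq: "mat_inner Z Y = (\<Sum>i<n. (Y *\<^sub>v w i) \<bullet> (Z *\<^sub>v w i))" .
  have "\<bar>mat_inner Z Y\<bar> \<le> (\<Sum>i<n. \<bar>(Y *\<^sub>v w i) \<bullet> (Z *\<^sub>v w i)\<bar>)" unfolding eq by (rule sum_abs)
  also have "\<dots> \<le> (\<Sum>i<n. vec_norm (Y *\<^sub>v w i) * vec_norm (w i))"
    using Y w by (intro sum_mono contr) auto
  also have "\<dots> = (\<Sum>i<n. vec_norm (Y *\<^sub>v w i))"
    by (intro sum.cong refl) (simp add: vec_norm_def orth)
  also have "\<dots> = nuclear_norm Y" by (simp add: nuclear_norm_def sv sum_unfold_sum_mset)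
  finally show ?thesis .
qed

text \<open>Up to the factor \<open>\<bar>s\<bar>\<close>, the singular values are the absolute
  coordinates of \<open>d\<close> in the basis. For nonzero \<open>s\<close> only one coordinate
  survives, so their sum is the Euclidean length of \<open>d\<close>, which is 1.\<close>

lemma nuclear_norm_rank_one_le:
  assumes c: "c \<in> carrier_vec m" "c \<bullet> c = 1" and d: "d \<in> carrier_vec n" "d \<bullet> d = 1"
  shows "nuclear_norm (s \<cdot>\<^sub>m outer_prod c d) \<le> \<bar>s\<bar>"
proof -
  define X where "X = s \<cdot>\<^sub>m outer_prod c d"
  have X: "X \<in> carrier_mat m n" using c d by (auto simp: X_def outer_prod_def)
  obtain w where "right_singular_basis X m n w" using ex_right_singular_basis[OF X] by blast
  then interpret right_singular_basis X m n w .
  define a where "a i = w i \<bullet> d" for i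
  have Xw: "X *\<^sub>v w i = (s * a i) \<cdot>\<^sub>v c" if "i < n" for i
  proof (rule eq_vecI)
    fix r assume "r < dim_vec ((s * a i) \<cdot>\<^sub>v c)"
    thus "(X *\<^sub>v w i) $ r = ((s * a i) \<cdot>\<^sub>v c) $ r"
      using c d w[OF that] by (simp add: X_def a_def scalar_prod_def outer_prod_def sum_distrib_left mult_ac)
  qed (use X c in auto)
  have Xsq: "(X *\<^sub>v w i) \<bullet> (X *\<^sub>v w j) = s\<^sup>2 * (a i * a j)" if "i < n" "j < n" for i j
    using that c by (simp add: Xw power2_eq_square)
  have nw: "vec_norm (X *\<^sub>v w i) = \<bar>s\<bar> * \<bar>a i\<bar>" if "i < n" for i
  proof -
    have "s\<^sup>2 * (a i * a i) = (s * a i)\<^sup>2" by (simp add: power2_eq_square)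
    thus ?thesis using that by (simp add: vec_norm_def Xsq abs_mult)
  qed
  \<comment> \<open>the vectors \<open>X w i = s a i c\<close> are parallel and pairwise orthogonal, so at most one is nonzero\<close>
  have cross: "\<bar>s\<bar> * (\<bar>a i\<bar> * \<bar>a j\<bar>) = (if i = j then \<bar>s\<bar> * (a i)\<^sup>2 else 0)" if "i < n" "j < n" for i j
  proof (cases "i = j")
    case False
    have "(X *\<^sub>v w i) \<bullet> (X *\<^sub>v w j) = (transpose_mat X *\<^sub>v (X *\<^sub>v w i)) \<bullet> w j"
      using X w that by (intro transpose_vec_mult_scalar[symmetric, of _ m n]) auto
    also have "\<dots> = 0" using False that
      by (simp add: eig orth smult_scalar_prod_distrib[OF w w])
    finally show ?thesis using False that by (simp add: Xsq)
  qed (simp add: power2_eq_square)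
  \<comment> \<open>The factor \<open>\<bar>s\<bar>\<close> is carried along because orthogonality
    makes the mixed products vanish only after multiplication by \<open>s\<close>.\<close>
  have "\<bar>s\<bar> * (\<Sum>i<n. \<bar>a i\<bar>)\<^sup>2 = (\<Sum>i<n. \<Sum>j<n. \<bar>s\<bar> * (\<bar>a i\<bar> * \<bar>a j\<bar>))"
    unfolding power2_eq_square sum_product by (simp only: sum_distrib_left)
  also have "\<dots> = (\<Sum>i<n. \<Sum>j<n. if i = j then \<bar>s\<bar> * (a i)\<^sup>2 else 0)"
    by (intro sum.cong refl) (simp add: cross)
  also have "\<dots> = \<bar>s\<bar> * (\<Sum>i<n. a i * a i)" by (simp add: sum_distrib_left power2_eq_square)
  also have "(\<Sum>i<n. a i * a i) = 1" using parseval[OF d(1) d(1)] d(2) by (simp add: a_def)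
  finally have sum_a: "\<bar>s\<bar> * (\<Sum>i<n. \<bar>a i\<bar>)\<^sup>2 = \<bar>s\<bar>" by simp
  have "nuclear_norm X = (\<Sum>i<n. vec_norm (X *\<^sub>v w i))"
    by (simp add: nuclear_norm_def sv sum_unfold_sum_mset)
  also have "\<dots> = \<bar>s\<bar> * (\<Sum>i<n. \<bar>a i\<bar>)" by (simp add: nw sum_distrib_left)
  also have "\<dots> \<le> \<bar>s\<bar>"
    using sum_a by (cases "s = 0") (auto simp: power2_eq_1_iff)
  finally show ?thesis by (simp add: X_def)
qed

lemma abs_entry_le_entry_max_norm:
  assumes "i < dim_row X" "j < dim_col X"
  shows "\<bar>X $$ (i, j)\<bar> \<le> entry_max_norm X"
  unfolding entry_max_norm_def
proof (rule Max_ge)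
  have "elements_mat X \<subseteq> (\<lambda>(i, j). X $$ (i, j)) ` ({..<dim_row X} \<times> {..<dim_col X})"
    by (auto simp: elements_mat_def)
  thus "finite (abs ` elements_mat X)" by (meson finite_SigmaI finite_imageI finite_lessThan finite_subset)
qed (use assms in auto)

lemma mat_inner_le_entry_sum_norm:
  assumes "V \<in> carrier_mat m n" "Y \<in> carrier_mat m n"
    and "\<And>i j. i < m \<Longrightarrow> j < n \<Longrightarrow> \<bar>V $$ (i, j)\<bar> \<le> 1"
  shows "\<bar>mat_inner V Y\<bar> \<le> entry_sum_norm Y"
proof -
  have "\<bar>mat_inner V Y\<bar> \<le> (\<Sum>i<m. \<bar>\<Sum>j<n. V $$ (i, j) * Y $$ (i, j)\<bar>)"
    using assms(1) unfolding mat_inner_def by (simp add: sum_abs)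
  also have "\<dots> \<le> (\<Sum>i<m. \<Sum>j<n. \<bar>V $$ (i, j) * Y $$ (i, j)\<bar>)"
    by (intro sum_mono sum_abs)
  also have "\<dots> \<le> (\<Sum>i<m. \<Sum>j<n. \<bar>Y $$ (i, j)\<bar>)"
    using assms(3) by (intro sum_mono) (simp add: abs_mult mult_left_le_one_le)
  also have "\<dots> = entry_sum_norm Y" using assms(2) by (simp add: entry_sum_norm_def)
  finally show ?thesis .
qed

section \<open>Rank-one and block matrices\<close>

lemma outer_prod_carrier [simp]:
  "u \<in> carrier_vec m \<Longrightarrow> v \<in> carrier_vec n \<Longrightarrow> outer_prod u v \<in> carrier_mat m n"
  by (auto simp: outer_prod_def)

lemma outer_prod_mult_vec:
  assumes "v \<in> carrier_vec n" "y \<in> carrier_vec n"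
  shows "outer_prod u v *\<^sub>v y = (v \<bullet> y) \<cdot>\<^sub>v u"
  by (rule eq_vecI) (use assms in \<open>auto simp: outer_prod_def scalar_prod_def sum_distrib_left mult_ac\<close>)

text \<open>Entries of product form bound the rank by one from above; a nonzero entry
  \<open>d $ j\<close> selects a column that is a nonzero multiple of \<open>c\<close>, hence
  independent.\<close>

lemma rank_outer_prod:
  assumes c: "c \<in> carrier_vec m" "c \<noteq> 0\<^sub>v m" and d: "d \<in> carrier_vec n" "d \<noteq> 0\<^sub>v n"
  shows "vec_space.rank m (outer_prod c d) = 1"
proof -
  interpret vec_space "TYPE(real)" m .
  have X: "outer_prod c d \<in> carrier_mat m n" using c d by simp
  have "rank (outer_prod c d) \<le> 1"
    by (rule rank_le_1_product_entries[OF X, of "($) c" "($) d"]) (auto simp: outer_prod_def)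
  moreover have "1 \<le> rank (outer_prod c d)"
  proof -
    obtain j where j: "j < n" "d $ j \<noteq> 0" using d by (metis carrier_vecD eq_vecI index_zero_vec)
    define x where "x = col (outer_prod c d) j"
    have x_eq: "x = d $ j \<cdot>\<^sub>v c"
      by (rule eq_vecI) (use c d j in \<open>auto simp: x_def outer_prod_def\<close>)
    hence x: "x \<in> carrier_vec m" using c by simp
    have x0: "a = 0" if "a \<cdot>\<^sub>v x = 0\<^sub>v m" for a
    proof -
      obtain i where "i < m" "c $ i \<noteq> 0" using c by (metis carrier_vecD eq_vecI index_zero_vec)
      moreover have "(a \<cdot>\<^sub>v x) $ i = 0\<^sub>v m $ i" using that by simp
      ultimately show ?thesis using j c by (simp add: x_eq)
    qed
    have "lin_indpt {x}"
    proof
      assume "lin_dep {x}"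
      then obtain A a v where A: "A \<subseteq> {x}" "lincomb a A = 0\<^sub>v m" "v \<in> A" "a v \<noteq> 0"
        unfolding lin_dep_def by auto
      hence "A = {x}" "v = x" by auto
      thus False using A x x0 by (simp add: lincomb_def finsum_insert)
    qed
    moreover have "{x} \<subseteq> set (cols (outer_prod c d))" using j X by (auto simp: x_def cols_def)
    ultimately show ?thesis using rank_ge_card_indpt[OF X, of "{x}"] by simp
  qed
  ultimately show ?thesis by simp
qed

lemma four_block_bilinear:
  fixes A :: "real mat"
  assumes "A \<in> carrier_mat m1 n1" "B \<in> carrier_mat m1 n2" "C \<in> carrier_mat m2 n1" "D \<in> carrier_mat m2 n2"
    and "x1 \<in> carrier_vec m1" "x2 \<in> carrier_vec m2" "y1 \<in> carrier_vec n1" "y2 \<in> carrier_vec n2"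
  shows "(x1 @\<^sub>v x2) \<bullet> (four_block_mat A B C D *\<^sub>v (y1 @\<^sub>v y2)) =
    x1 \<bullet> (A *\<^sub>v y1) + x1 \<bullet> (B *\<^sub>v y2) + x2 \<bullet> (C *\<^sub>v y1) + x2 \<bullet> (D *\<^sub>v y2)"
proof -
  note mv = mult_mat_vec_carrier
  show ?thesis
    using assms
    by (simp add: four_block_mat_mult_vec[OF assms(1-4,7,8)]
        scalar_prod_append[OF assms(5,6) add_carrier_vec[OF mv mv] add_carrier_vec[OF mv mv]]
        scalar_prod_add_distrib[OF assms(5) mv mv] scalar_prod_add_distrib[OF assms(6) mv mv])
qed

lemma mult_mat_zero_vec: "A *\<^sub>v 0\<^sub>v (dim_col A) = (0\<^sub>v (dim_row A) :: real vec)"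
  by (rule eq_vecI) auto

text \<open>Padding the arguments with zeros embeds a block into \<open>A\<close> without changing
  any length. Bounding by the norm of the whole matrix also covers blocks without columns, whose own
  \<open>spectral_norm\<close> is unspecified.\<close>

lemma abs_bilinear_block_le:
  assumes blocks: "A11 \<in> carrier_mat m1 n1" "A12 \<in> carrier_mat m1 n2" "A21 \<in> carrier_mat m2 n1" "A22 \<in> carrier_mat m2 n2"
    and A: "A = four_block_mat A11 A12 A21 A22"
    and n: "0 < n1 + n2"
    and x1: "x1 \<in> carrier_vec m1" and x2: "x2 \<in> carrier_vec m2"
    and y1: "y1 \<in> carrier_vec n1" and y2: "y2 \<in> carrier_vec n2"
  shows "\<bar>x1 \<bullet> (A11 *\<^sub>v y1)\<bar> \<le> spectral_norm A * (vec_norm x1 * vec_norm y1)"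
    and "\<bar>x1 \<bullet> (A12 *\<^sub>v y2)\<bar> \<le> spectral_norm A * (vec_norm x1 * vec_norm y2)"
    and "\<bar>x2 \<bullet> (A21 *\<^sub>v y1)\<bar> \<le> spectral_norm A * (vec_norm x2 * vec_norm y1)"
    and "\<bar>x2 \<bullet> (A22 *\<^sub>v y2)\<bar> \<le> spectral_norm A * (vec_norm x2 * vec_norm y2)"
proof -
  have A': "A \<in> carrier_mat (m1 + m2) (n1 + n2)" using blocks by (simp add: A)
  have bound: "\<bar>(p @\<^sub>v p') \<bullet> (A *\<^sub>v (q @\<^sub>v q'))\<bar> \<le>
      spectral_norm A * (vec_norm (p @\<^sub>v p') * vec_norm (q @\<^sub>v q'))"
    if "p \<in> carrier_vec m1" "p' \<in> carrier_vec m2" "q \<in> carrier_vec n1" "q' \<in> carrier_vec n2" for p p' q q'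
    using that by (intro abs_bilinear_le_spectral_norm[OF A' _ _ n]) auto
  have zero: "vec_norm (0\<^sub>v k) = 0" for k by (simp add: vec_norm_def)
  have pad: "vec_norm (p @\<^sub>v 0\<^sub>v k) = vec_norm p" "vec_norm (0\<^sub>v k @\<^sub>v p) = vec_norm p" for p k
    using vec_norm_append[of p "dim_vec p" "0\<^sub>v k" k] vec_norm_append[of "0\<^sub>v k" k p "dim_vec p"]
    by (auto simp: zero vec_norm_nonneg)
  have mul: "A11 *\<^sub>v 0\<^sub>v n1 = 0\<^sub>v m1" "A12 *\<^sub>v 0\<^sub>v n2 = 0\<^sub>v m1"
    "A21 *\<^sub>v 0\<^sub>v n1 = 0\<^sub>v m2" "A22 *\<^sub>v 0\<^sub>v n2 = 0\<^sub>v m2"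
    using blocks[THEN carrier_matD(1)] blocks[THEN carrier_matD(2)] by (metis mult_mat_zero_vec)+
  have bil: "(p @\<^sub>v p') \<bullet> (A *\<^sub>v (q @\<^sub>v q')) =
      p \<bullet> (A11 *\<^sub>v q) + p \<bullet> (A12 *\<^sub>v q') + p' \<bullet> (A21 *\<^sub>v q) + p' \<bullet> (A22 *\<^sub>v q')"
    if "p \<in> carrier_vec m1" "p' \<in> carrier_vec m2" "q \<in> carrier_vec n1" "q' \<in> carrier_vec n2" for p p' q q'
    unfolding A by (rule four_block_bilinear[OF blocks that])
  note car = blocks[THEN mult_mat_vec_carrier]
  show "\<bar>x1 \<bullet> (A11 *\<^sub>v y1)\<bar> \<le> spectral_norm A * (vec_norm x1 * vec_norm y1)"
    using bound[OF x1 zero_carrier_vec y1 zero_carrier_vec] bil[OF x1 zero_carrier_vec y1 zero_carrier_vec]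
      x1 car(3)[OF y1] by (simp add: pad mul)
  show "\<bar>x1 \<bullet> (A12 *\<^sub>v y2)\<bar> \<le> spectral_norm A * (vec_norm x1 * vec_norm y2)"
    using bound[OF x1 zero_carrier_vec zero_carrier_vec y2] bil[OF x1 zero_carrier_vec zero_carrier_vec y2]
      x1 car(4)[OF y2] by (simp add: pad mul)
  show "\<bar>x2 \<bullet> (A21 *\<^sub>v y1)\<bar> \<le> spectral_norm A * (vec_norm x2 * vec_norm y1)"
    using bound[OF zero_carrier_vec x2 y1 zero_carrier_vec] bil[OF zero_carrier_vec x2 y1 zero_carrier_vec]
      x2 car(1)[OF y1] by (simp add: pad mul)
  show "\<bar>x2 \<bullet> (A22 *\<^sub>v y2)\<bar> \<le> spectral_norm A * (vec_norm x2 * vec_norm y2)"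
    using bound[OF zero_carrier_vec x2 zero_carrier_vec y2] bil[OF zero_carrier_vec x2 zero_carrier_vec y2]
      x2 car(2)[OF y2] by (simp add: pad mul)
qed

lemma mat_inner_outer_prod:
  assumes A: "A \<in> carrier_mat m n" and c: "c \<in> carrier_vec m" and d: "d \<in> carrier_vec n"
  shows "mat_inner A (s \<cdot>\<^sub>m outer_prod c d) = s * (c \<bullet> (A *\<^sub>v d))"
  using assms
  by (simp add: mat_inner_def outer_prod_def scalar_prod_def sum_distrib_left atLeast0LessThan mult_ac)

lemma entry_sum_norm_outer_prod:
  assumes c: "c \<in> carrier_vec m" "0\<^sub>v m \<le> c" and d: "d \<in> carrier_vec n" "0\<^sub>v n \<le> d"
  shows "entry_sum_norm (s \<cdot>\<^sub>m outer_prod c d) = \<bar>s\<bar> * ((\<Sum>i<m. c $ i) * (\<Sum>j<n. d $ j))"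
proof -
  have "entry_sum_norm (s \<cdot>\<^sub>m outer_prod c d) = (\<Sum>i<m. \<Sum>j<n. \<bar>s\<bar> * (c $ i * d $ j))"
    using assms by (simp add: entry_sum_norm_def outer_prod_def abs_mult less_eq_vec_def)
  thus ?thesis unfolding sum_product by (simp only: sum_distrib_left)
qed

section \<open>Dual certificates\<close>

text \<open>Weak duality: pairing \<open>split\<close> with a feasible \<open>Y\<close>, whose inner
  product with \<open>A\<close> is 1, expresses \<open>l\<close> through \<open>Z\<close> and
  \<open>V\<close>. Absolute values are used since the sign of \<open>l\<close> is not
  fixed.\<close>

lemma optimal_from_dual_certificate:
  assumes A: "A \<in> carrier_mat m n" and Z: "Z \<in> carrier_mat m n" and V: "V \<in> carrier_mat m n"
    and \<theta>: "0 \<le> \<theta>" and split: "l \<cdot>\<^sub>m A = Z + \<theta> \<cdot>\<^sub>m V"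
    and contr: "\<And>x y. x \<in> carrier_vec m \<Longrightarrow> y \<in> carrier_vec n \<Longrightarrow> \<bar>x \<bullet> (Z *\<^sub>v y)\<bar> \<le> vec_norm x * vec_norm y"
    and V1: "\<And>i j. i < m \<Longrightarrow> j < n \<Longrightarrow> \<bar>V $$ (i, j)\<bar> \<le> 1"
    and X: "feasible A X" "objective \<theta> X \<le> \<bar>l\<bar>"
  shows "optimal_solution A \<theta> X"
  unfolding optimal_solution_def
proof (intro conjI allI impI X(1))
  fix Y assume "feasible A Y"
  hence Y: "Y \<in> carrier_mat m n" "mat_inner A Y = 1" using A by (auto simp: feasible_def)
  have "l = mat_inner (l \<cdot>\<^sub>m A) Y"
    using A Y by (simp add: mat_inner_def mult.assoc flip: sum_distrib_left)
  also have "\<dots> = mat_inner Z Y + \<theta> * mat_inner V Y"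
    using Z V Y by (simp add: split mat_inner_def distrib_right sum.distrib sum_distrib_left mult.assoc)
  finally have "\<bar>l\<bar> \<le> \<bar>mat_inner Z Y\<bar> + \<theta> * \<bar>mat_inner V Y\<bar>"
    using \<theta> by (metis abs_mult abs_of_nonneg abs_triangle_ineq)
  also have "\<dots> \<le> nuclear_norm Y + \<theta> * entry_sum_norm Y"
    using nuclear_norm_dual[OF Z Y(1) contr] mat_inner_le_entry_sum_norm[OF V Y(1) V1] \<theta>
    by (intro add_mono mult_left_mono) auto
  finally show "objective \<theta> X \<le> objective \<theta> Y" using X(2) by (simp add: objective_def)
qed

text \<open>Cauchy-Schwarz in the plane; it joins estimates made on orthogonal components.\<close>

lemma add_mult_le_sqrt:
  "a * c + b * d \<le> sqrt (a\<^sup>2 + b\<^sup>2) * sqrt (c\<^sup>2 + d\<^sup>2)"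
proof -
  have "(a * c + b * d)\<^sup>2 \<le> (a\<^sup>2 + b\<^sup>2) * (c\<^sup>2 + d\<^sup>2)"
    using zero_le_power2[of "a * d - b * c"] by (simp add: power2_eq_square algebra_simps)
  hence "a * c + b * d \<le> sqrt ((a\<^sup>2 + b\<^sup>2) * (c\<^sup>2 + d\<^sup>2))" by (rule real_le_rsqrt)
  thus ?thesis by (simp add: real_sqrt_mult)
qed

lemma smult_mat_mult_vec:
  fixes A :: "real mat"
  assumes "A \<in> carrier_mat m n" "v \<in> carrier_vec n"
  shows "(k \<cdot>\<^sub>m A) *\<^sub>v v = k \<cdot>\<^sub>v (A *\<^sub>v v)"
  by (rule eq_vecI) (use assms in \<open>auto simp: scalar_prod_def sum_distrib_left mult_ac\<close>)

lemma unit_vec_decomposition: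
  assumes c: "c \<in> carrier_vec n" "c \<bullet> c = 1" and x: "x \<in> carrier_vec n"
  defines "p \<equiv> x - (c \<bullet> x) \<cdot>\<^sub>v c"
  shows "p \<in> carrier_vec n" "x = (c \<bullet> x) \<cdot>\<^sub>v c + p" "c \<bullet> p = 0"
    "(vec_norm x)\<^sup>2 = (c \<bullet> x)\<^sup>2 + (vec_norm p)\<^sup>2"
proof -
  show p: "p \<in> carrier_vec n" using c x by (simp add: p_def)
  show dec: "x = (c \<bullet> x) \<cdot>\<^sub>v c + p" by (rule eq_vecI) (use c x in \<open>auto simp: p_def\<close>)
  show cp: "c \<bullet> p = 0"
    using c x by (simp add: p_def scalar_prod_minus_distrib[of _ n])
  have "x \<bullet> x = ((c \<bullet> x) \<cdot>\<^sub>v c + p) \<bullet> ((c \<bullet> x) \<cdot>\<^sub>v c + p)" using dec by simp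
  also have "\<dots> = (c \<bullet> x)\<^sup>2 + p \<bullet> p"
    using c p cp comm_scalar_prod[OF p c(1)]
    by (simp add: add_scalar_prod_distrib[of _ n] scalar_prod_add_distrib[of _ n] power2_eq_square)
  finally show "(vec_norm x)\<^sup>2 = (c \<bullet> x)\<^sup>2 + (vec_norm p)\<^sup>2" by (simp add: vec_norm_sq)
qed

text \<open>Here \<open>\<delta>\<close> plays the role of \<open>ls - l\<close>. The form splits
  over the lines spanned by \<open>us\<close> and \<open>vs\<close> and their orthogonal complements
  and is a contraction on both parts, hence on the whole space. The off-diagonal blocks contain no
  multiple of \<open>\<delta>\<close>; that change goes into the entrywise half of the
  certificate.\<close>

lemma perturbed_certificate_contraction:
  assumes A: "A11 \<in> carrier_mat M N" "A12 \<in> carrier_mat M N'" "A21 \<in> carrier_mat M' N" "A22 \<in> carrier_mat M' N'"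
    and W: "W11 \<in> carrier_mat M N" "W12 \<in> carrier_mat M N'" "W21 \<in> carrier_mat M' N" "W22 \<in> carrier_mat M' N'"
    and N: "0 < N"
    and us: "us \<in> carrier_vec M" "us \<bullet> us = 1" and vs: "vs \<in> carrier_vec N" "vs \<bullet> vs = 1"
    and u: "u \<in> carrier_vec M" "vec_norm (u - us) \<le> \<epsilon>" and v: "v \<in> carrier_vec N" "vec_norm (v - vs) \<le> \<epsilon>"
    and \<delta>: "\<bar>\<delta>\<bar> \<le> \<epsilon>"
    and B: "B = W11 + \<delta> \<cdot>\<^sub>m A11 + outer_prod u v" "B *\<^sub>v vs = us" "transpose_mat B *\<^sub>v us = vs"
    and small: "spectral_norm (four_block_mat W11 W12 W21 W22)
      + \<epsilon> * spectral_norm (four_block_mat A11 A12 A21 A22) + \<epsilon>\<^sup>2 \<le> 1"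
    and x: "x \<in> carrier_vec (M + M')" and y: "y \<in> carrier_vec (N + N')"
  defines "Z \<equiv> four_block_mat B (W12 - outer_prod us (transpose_mat W12 *\<^sub>v us))
      (W21 - outer_prod (W21 *\<^sub>v vs) vs) (W22 + \<delta> \<cdot>\<^sub>m A22)"
  shows "\<bar>x \<bullet> (Z *\<^sub>v y)\<bar> \<le> vec_norm x * vec_norm y"
proof -
  define x1 where "x1 = vec_first x M"
  define x2 where "x2 = vec_last x M'"
  define y1 where "y1 = vec_first y N"
  define y2 where "y2 = vec_last y N'"
  have x_eq: "x = x1 @\<^sub>v x2" and y_eq: "y = y1 @\<^sub>v y2" using x y by (simp_all add: x1_def x2_def y1_def y2_def)
  have x1: "x1 \<in> carrier_vec M" and x2: "x2 \<in> carrier_vec M'"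
    and y1: "y1 \<in> carrier_vec N" and y2: "y2 \<in> carrier_vec N'"
    by (simp_all add: x1_def x2_def y1_def y2_def)
  define \<alpha> where "\<alpha> = us \<bullet> x1"
  define \<beta> where "\<beta> = vs \<bullet> y1"
  define p where "p = x1 - \<alpha> \<cdot>\<^sub>v us"
  define q where "q = y1 - \<beta> \<cdot>\<^sub>v vs"
  note px = unit_vec_decomposition[OF us x1, folded \<alpha>_def, folded p_def]
  note qy = unit_vec_decomposition[OF vs y1, folded \<beta>_def, folded q_def]
  have p: "p \<in> carrier_vec M" and q: "q \<in> carrier_vec N" by (rule px qy)+
  have Bc: "B \<in> carrier_mat M N" using B(1) A W u v by simp
  have mv: "W11 *\<^sub>v q \<in> carrier_vec M" "W12 *\<^sub>v y2 \<in> carrier_vec M" "W21 *\<^sub>v q \<in> carrier_vec M'"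
    "W22 *\<^sub>v y2 \<in> carrier_vec M'" "A11 *\<^sub>v q \<in> carrier_vec M" "A22 *\<^sub>v y2 \<in> carrier_vec M'"
    "B *\<^sub>v q \<in> carrier_vec M"
    using A W Bc p q y2 by auto

  \<comment> \<open>\<open>B\<close> exchanges \<open>us\<close> and \<open>vs\<close>, so the mixed
    terms vanish and the pure term is \<open>\<alpha> * \<beta>\<close>. Only on the complements is
    \<open>B\<close> expanded through \<open>W11\<close>.\<close>
  have e11: "x1 \<bullet> (B *\<^sub>v y1) = \<alpha> * \<beta> + (p \<bullet> (W11 *\<^sub>v q) + \<delta> * (p \<bullet> (A11 *\<^sub>v q)) + (p \<bullet> u) * (v \<bullet> q))"
  proof -
    have "B *\<^sub>v y1 = \<beta> \<cdot>\<^sub>v us + B *\<^sub>v q"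
      by (subst qy(2)) (simp add: mult_add_distrib_mat_vec[OF Bc _ q] vs mult_mat_vec[OF Bc vs(1)] B(2))
    hence "x1 \<bullet> (B *\<^sub>v y1) = \<alpha> * \<beta> + x1 \<bullet> (B *\<^sub>v q)"
      using x1 us mv by (simp add: scalar_prod_add_distrib[of _ M] \<alpha>_def comm_scalar_prod[OF x1 us(1)])
    also have "x1 \<bullet> (B *\<^sub>v q) = \<alpha> * (us \<bullet> (B *\<^sub>v q)) + p \<bullet> (B *\<^sub>v q)"
      by (subst px(2)) (use us p mv in \<open>simp add: add_scalar_prod_distrib[of _ M]\<close>)
    also have "us \<bullet> (B *\<^sub>v q) = 0"
      using transpose_vec_mult_scalar[OF Bc q us(1)] B(3) qy(3) by simp
    also have "B *\<^sub>v q = W11 *\<^sub>v q + \<delta> \<cdot>\<^sub>v (A11 *\<^sub>v q) + (v \<bullet> q) \<cdot>\<^sub>v u"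
      unfolding B(1) using A W u v q
      by (simp add: add_mult_distrib_mat_vec[of _ M N] outer_prod_mult_vec[of _ N] smult_mat_mult_vec[of _ M N]
          assoc_add_vec[of _ M])
    also have "p \<bullet> \<dots> = p \<bullet> (W11 *\<^sub>v q) + \<delta> * (p \<bullet> (A11 *\<^sub>v q)) + (p \<bullet> u) * (v \<bullet> q)"
      using p u mv by (simp add: scalar_prod_add_distrib[of _ M])
    finally show ?thesis by simp
  qed
  \<comment> \<open>The subtracted matrix is us us^T W12: the projection acts from the left and
    turns \<open>x1\<close> into \<open>p\<close>.\<close>
  have e12: "x1 \<bullet> ((W12 - outer_prod us (transpose_mat W12 *\<^sub>v us)) *\<^sub>v y2) = p \<bullet> (W12 *\<^sub>v y2)"
  proof -
    have "(W12 - outer_prod us (transpose_mat W12 *\<^sub>v us)) *\<^sub>v y2 =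
        W12 *\<^sub>v y2 - (us \<bullet> (W12 *\<^sub>v y2)) \<cdot>\<^sub>v us"
      using W us y2 transpose_vec_mult_scalar[OF W(2) y2 us(1)]
      by (simp add: minus_mult_distrib_mat_vec[of _ M N'] outer_prod_mult_vec[of _ N'])
    thus ?thesis
      using x1 us mv by (simp add: p_def scalar_prod_minus_distrib[of _ M] minus_scalar_prod_distrib[of _ M]
          comm_scalar_prod[OF x1 us(1)] \<alpha>_def)
  qed
  \<comment> \<open>Here the projection acts from the right and turns \<open>y1\<close> into
    \<open>q\<close>.\<close>
  have e21: "(W21 - outer_prod (W21 *\<^sub>v vs) vs) *\<^sub>v y1 = W21 *\<^sub>v q"
    unfolding q_def using W vs y1
    by (simp add: minus_mult_distrib_mat_vec[of _ M' N] outer_prod_mult_vec[of _ N] \<beta>_def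
        mult_minus_distrib_mat_vec[of _ M' N] mult_mat_vec[of _ M' N])
  have e22: "x2 \<bullet> ((W22 + \<delta> \<cdot>\<^sub>m A22) *\<^sub>v y2) = x2 \<bullet> (W22 *\<^sub>v y2) + \<delta> * (x2 \<bullet> (A22 *\<^sub>v y2))"
    using W A x2 y2 mv
    by (simp add: add_mult_distrib_mat_vec[of _ M' N'] smult_mat_mult_vec[of _ M' N'] scalar_prod_add_distrib[of _ M'])

  define sW where "sW = spectral_norm (four_block_mat W11 W12 W21 W22)"
  define sA where "sA = spectral_norm (four_block_mat A11 A12 A21 A22)"
  define P where "P = vec_norm (p @\<^sub>v x2)"
  define R where "R = vec_norm (q @\<^sub>v y2)"
  have PR: "0 \<le> P" "0 \<le> R" by (simp_all add: P_def R_def vec_norm_nonneg)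
  have cv: "transpose_mat W12 *\<^sub>v us \<in> carrier_vec N'" "W21 *\<^sub>v vs \<in> carrier_vec M'"
    using W us vs by auto
  have "x \<bullet> (Z *\<^sub>v y) = x1 \<bullet> (B *\<^sub>v y1) + x1 \<bullet> ((W12 - outer_prod us (transpose_mat W12 *\<^sub>v us)) *\<^sub>v y2)
      + x2 \<bullet> ((W21 - outer_prod (W21 *\<^sub>v vs) vs) *\<^sub>v y1) + x2 \<bullet> ((W22 + \<delta> \<cdot>\<^sub>m A22) *\<^sub>v y2)"
    unfolding Z_def x_eq y_eq using A W Bc us vs x1 x2 y1 y2 cv
    by (intro four_block_bilinear) (auto intro!: minus_carrier_mat)
  also have "\<dots> = \<alpha> * \<beta> + (p @\<^sub>v x2) \<bullet> (four_block_mat W11 W12 W21 W22 *\<^sub>v (q @\<^sub>v y2))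
      + \<delta> * (p \<bullet> (A11 *\<^sub>v q) + x2 \<bullet> (A22 *\<^sub>v y2)) + (p \<bullet> u) * (v \<bullet> q)"
    unfolding four_block_bilinear[OF W p x2 q y2] e11 e12 e21 e22 by (simp add: algebra_simps)
  finally have xZy: "x \<bullet> (Z *\<^sub>v y) = \<dots>" .

  have bW: "\<bar>(p @\<^sub>v x2) \<bullet> (four_block_mat W11 W12 W21 W22 *\<^sub>v (q @\<^sub>v y2))\<bar> \<le> sW * (P * R)"
    unfolding sW_def P_def R_def
    by (rule abs_bilinear_le_spectral_norm[of _ "M + M'" "N + N'"]) (use W p q x2 y2 N in auto)
  have NN: "0 < N + N'" using N by simp
  have A_car: "four_block_mat A11 A12 A21 A22 \<in> carrier_mat (M + M') (N + N')" using A by simp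
  have sA: "0 \<le> sA" unfolding sA_def by (rule vec_norm_mult_mat_vec_le[OF A_car y NN])
  note bA = abs_bilinear_block_le[OF A refl NN p x2 q y2, folded sA_def]
  \<comment> \<open>Only the diagonal blocks of \<open>A\<close> enter; their joint form is still
    bounded by the norm of \<open>A\<close>.\<close>
  have "\<bar>p \<bullet> (A11 *\<^sub>v q) + x2 \<bullet> (A22 *\<^sub>v y2)\<bar> \<le> sA * (vec_norm p * vec_norm q + vec_norm x2 * vec_norm y2)"
    using bA(1,4) by (simp add: distrib_left)
  also have "\<dots> \<le> sA * (P * R)"
    unfolding P_def R_def vec_norm_append[OF p x2] vec_norm_append[OF q y2]
    by (intro mult_left_mono add_mult_le_sqrt sA)
  finally have "\<bar>\<delta> * (p \<bullet> (A11 *\<^sub>v q) + x2 \<bullet> (A22 *\<^sub>v y2))\<bar> \<le> \<epsilon> * (sA * (P * R))"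
    unfolding abs_mult using \<delta> by (intro mult_mono) auto
  moreover have "\<bar>(p \<bullet> u) * (v \<bullet> q)\<bar> \<le> \<epsilon>\<^sup>2 * (P * R)"
  proof -
    have \<epsilon>: "0 \<le> \<epsilon>" using \<delta> by linarith
    \<comment> \<open>\<open>p\<close> and \<open>q\<close> are orthogonal to \<open>us\<close> and \<open>vs\<close>, so both factors are small\<close>
    have "p \<bullet> u = p \<bullet> (u - us)" "v \<bullet> q = (v - vs) \<bullet> q"
      using p q u v us vs px(3) qy(3) comm_scalar_prod[OF us(1) p]
      by (simp_all add: scalar_prod_minus_distrib[of _ M] minus_scalar_prod_distrib[of _ N])
    moreover have "vec_norm p \<le> P" "vec_norm q \<le> R"
      unfolding P_def R_def vec_norm_append[OF p x2] vec_norm_append[OF q y2] by simp_all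
    moreover have "\<bar>p \<bullet> (u - us)\<bar> \<le> vec_norm p * vec_norm (u - us)" "\<bar>(v - vs) \<bullet> q\<bar> \<le> vec_norm (v - vs) * vec_norm q"
      using p q u v us vs by (auto intro!: abs_scalar_prod_le)
    ultimately have "\<bar>p \<bullet> u\<bar> \<le> P * \<epsilon>" "\<bar>v \<bullet> q\<bar> \<le> \<epsilon> * R"
      using u(2) v(2) PR \<epsilon> by (auto intro: order_trans mult_mono vec_norm_nonneg)
    hence "\<bar>p \<bullet> u\<bar> * \<bar>v \<bullet> q\<bar> \<le> (P * \<epsilon>) * (\<epsilon> * R)" using PR \<epsilon> by (intro mult_mono) auto
    thus ?thesis by (simp add: abs_mult power2_eq_square mult_ac)
  qed
  ultimately have "\<bar>x \<bullet> (Z *\<^sub>v y)\<bar> \<le> \<bar>\<alpha> * \<beta>\<bar> + (sW + \<epsilon> * sA + \<epsilon>\<^sup>2) * (P * R)"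
    using bW unfolding xZy by (simp add: distrib_right)
  also have "\<dots> \<le> \<bar>\<alpha>\<bar> * \<bar>\<beta>\<bar> + 1 * (P * R)"
    unfolding abs_mult using small PR by (intro add_left_mono mult_right_mono) (auto simp: sW_def sA_def)
  \<comment> \<open>By Pythagoras the plane vectors (\<open>\<bar>\<alpha>\<bar>\<close>,
    \<open>P\<close>) and (\<open>\<bar>\<beta>\<bar>\<close>, \<open>R\<close>) have the lengths of
    \<open>x\<close> and \<open>y\<close>.\<close>
  also have "\<dots> \<le> sqrt (\<bar>\<alpha>\<bar>\<^sup>2 + P\<^sup>2) * sqrt (\<bar>\<beta>\<bar>\<^sup>2 + R\<^sup>2)" using add_mult_le_sqrt[of "\<bar>\<alpha>\<bar>" "\<bar>\<beta>\<bar>" P R] by simp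
  also have "\<bar>\<alpha>\<bar>\<^sup>2 + P\<^sup>2 = (vec_norm x)\<^sup>2"
    using px(4) by (simp add: x_eq P_def vec_norm_append[OF p x2] vec_norm_append[OF x1 x2])
  also have "\<bar>\<beta>\<bar>\<^sup>2 + R\<^sup>2 = (vec_norm y)\<^sup>2"
    using qy(4) by (simp add: y_eq R_def vec_norm_append[OF q y2] vec_norm_append[OF y1 y2])
  finally show ?thesis by (simp add: vec_norm_nonneg)
qed

text \<open>Makes the facts about rank-one matrices applicable to the candidate at full
  size.\<close>

lemma rank_one_block_eq_outer_prod:
  assumes "u \<in> carrier_vec M" "v \<in> carrier_vec N" "M \<le> m" "N \<le> n"
  shows "rank_one_block m n s u v = s \<cdot>\<^sub>m outer_prod (u @\<^sub>v 0\<^sub>v (m - M)) (v @\<^sub>v 0\<^sub>v (n - N))"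
  by (rule eq_matI) (use assms in \<open>auto simp: rank_one_block_def outer_prod_def Let_def\<close>)

lemma eps_solution_bounds:
  assumes us: "us \<in> carrier_vec M" and vs: "vs \<in> carrier_vec N"
    and "eps_solution M N \<epsilon> ls us vs l u v"
  shows "u \<in> carrier_vec M" "v \<in> carrier_vec N" "\<bar>ls - l\<bar> \<le> \<epsilon>"
    "vec_norm (u - us) \<le> \<epsilon>" "vec_norm (v - vs) \<le> \<epsilon>"
proof -
  show "u \<in> carrier_vec M" "v \<in> carrier_vec N" using assms(3) by (auto simp: eps_solution_def)
  have t: "triple_norm (l - ls) (u - us) (v - vs) \<le> \<epsilon>" using assms(3) by (simp add: eps_solution_def)
  have "\<bar>ls - l\<bar> \<le> triple_norm (l - ls) (u - us) (v - vs)"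
    unfolding triple_norm_def
    by (rule real_le_rsqrt) (simp add: scalar_prod_self_nonneg power2_commute[of l])
  moreover have "vec_norm (u - us) \<le> triple_norm (l - ls) (u - us) (v - vs)"
    "vec_norm (v - vs) \<le> triple_norm (l - ls) (u - us) (v - vs)"
    unfolding triple_norm_def vec_norm_def by (simp_all add: scalar_prod_self_nonneg)
  ultimately show "\<bar>ls - l\<bar> \<le> \<epsilon>" "vec_norm (u - us) \<le> \<epsilon>" "vec_norm (v - vs) \<le> \<epsilon>" using t by auto
qed

lemma abs_entry_le_vec_norm:
  assumes "x \<in> carrier_vec n" "i < n"
  shows "\<bar>x $ i\<bar> \<le> vec_norm x"
proof -
  have "vec_norm (unit_vec n i) = 1" using assms by (simp add: vec_norm_def)
  thus ?thesis using abs_scalar_prod_le[OF unit_vec_carrier assms(1), of i] assms by simp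
qed

text \<open>The slack in the bound on \<open>V\<close> pays for two changes:
  \<open>\<delta> * a\<close> costs at most \<open>b * \<epsilon>\<close> and \<open>w\<close> at
  most \<open>\<epsilon>\<close>, together within \<open>(b + 5) * \<epsilon>\<close>.\<close>

lemma abs_perturbed_entry_le:
  fixes \<theta> a b \<delta> w V \<epsilon> :: real
  assumes \<theta>: "0 < \<theta>" and V: "\<bar>V\<bar> \<le> 1 - inverse \<theta> * (b + 5) * \<epsilon>"
    and "\<bar>\<delta>\<bar> \<le> \<epsilon>" and "\<bar>a\<bar> \<le> b" and "\<bar>w\<bar> \<le> \<epsilon>"
  shows "\<bar>V + inverse \<theta> * (\<delta> * a + w)\<bar> \<le> 1"
proof -
  have "\<bar>\<delta> * a\<bar> \<le> \<epsilon> * b" unfolding abs_mult using assms by (intro mult_mono) auto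
  moreover have "0 \<le> \<epsilon>" using assms by linarith
  ultimately have "\<bar>\<delta> * a + w\<bar> \<le> (b + 5) * \<epsilon>" using assms(5) abs_triangle_ineq[of "\<delta> * a" w]
    by (simp add: algebra_simps)
  hence "inverse \<theta> * \<bar>\<delta> * a + w\<bar> \<le> inverse \<theta> * ((b + 5) * \<epsilon>)" using \<theta> by (intro mult_left_mono) auto
  hence "\<bar>inverse \<theta> * (\<delta> * a + w)\<bar> \<le> inverse \<theta> * (b + 5) * \<epsilon>" using \<theta> by (simp add: abs_mult mult.assoc)
  thus ?thesis using V by linarith
qed

text \<open>The entrywise bounds on the outer blocks are guarded by \<open>N < n\<close> and
  \<open>M < m\<close>, since \<open>entry_max_norm\<close> of an empty block is unspecified. The
  scalar is characterized as the only one meeting the constraint.\<close>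

theorem proposition1:
  fixes A A11 A12 A21 A22 W W11 W12 W21 W22 V V11 V12 V21 V22 :: "real mat"
    and m n M N :: nat
    and \<theta> \<epsilon> ls l :: real
    and us vs u v :: "real vec"
  assumes "A \<in> carrier_mat m n" and "A \<noteq> 0\<^sub>m m n"
    and "\<theta> > 0"
    and "1 \<le> M" and "M \<le> m" and "1 \<le> N" and "N \<le> n"
    and "0 < \<epsilon>" and "\<epsilon> < 1 / 2"
    and "split_block A M N = (A11, A12, A21, A22)"
    and "solves_system M N A11 \<theta> ls us vs" and "0\<^sub>v M \<le> us" and "0\<^sub>v N \<le> vs"
    and "eps_solution M N \<epsilon> ls us vs l u v"
    and "W \<in> carrier_mat m n" and "split_block W M N = (W11, W12, W21, W22)"
    and "V \<in> carrier_mat m n" and "split_block V M N = (V11, V12, V21, V22)"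
    and "W11 = (l \<cdot>\<^sub>m A11 - \<theta> \<cdot>\<^sub>m V11) - outer_prod u v"
    and "V11 = ones_mat M N"
    and "W12 = l \<cdot>\<^sub>m A12 - \<theta> \<cdot>\<^sub>m V12"
    and "transpose_mat W12 *\<^sub>v u = 0\<^sub>v (n - N)"
    and "N < n \<Longrightarrow> entry_max_norm V12 \<le> 1 - inverse \<theta> * (entry_max_norm A12 + 5) * \<epsilon>"
    and "W21 = l \<cdot>\<^sub>m A21 - \<theta> \<cdot>\<^sub>m V21"
    and "W21 *\<^sub>v v = 0\<^sub>v (m - M)"
    and "M < m \<Longrightarrow> entry_max_norm V21 \<le> 1 - inverse \<theta> * (entry_max_norm A21 + 5) * \<epsilon>"
    and "W22 = l \<cdot>\<^sub>m A22 - \<theta> \<cdot>\<^sub>m V22"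
    and "M < m \<Longrightarrow> N < n \<Longrightarrow> entry_max_norm V22 \<le> 1"
    and "spectral_norm W \<le> 1 - (spectral_norm A + 7.5) * \<epsilon>"
  shows "\<exists>\<sigma>. (\<forall>s. mat_inner A (rank_one_block m n s us vs) = 1 \<longleftrightarrow> s = \<sigma>) \<and>
             vec_space.rank m (rank_one_block m n \<sigma> us vs) = 1 \<and>
             optimal_solution A \<theta> (rank_one_block m n \<sigma> us vs)"
proof -
  note A = assms(1) and \<theta> = assms(3) and M = assms(4,5) and N = assms(6,7) and \<epsilon> = assms(8,9)
    and us0 = assms(12) and vs0 = assms(13) and W = assms(15) and V = assms(17)
    and W11 = assms(19) and V11 = assms(20) and W12 = assms(21) and W12u = assms(22) and V12 = assms(23)
    and W21 = assms(24) and W21v = assms(25) and V21 = assms(26) and W22 = assms(27) and V22 = assms(28)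
    and normW = assms(29)

  \<comment> \<open>Block decomposition and the exact system\<close>
  define M' where "M' = m - M"
  define N' where "N' = n - N"
  have m: "m = M + M'" and n: "n = N + N'" using M N by (simp_all add: M'_def N'_def)
  have Ab: "A11 \<in> carrier_mat M N" "A12 \<in> carrier_mat M N'" "A21 \<in> carrier_mat M' N" "A22 \<in> carrier_mat M' N'"
    and A_eq: "A = four_block_mat A11 A12 A21 A22"
    using split_block[OF assms(10), of M' N'] A m n by auto
  have Wb: "W11 \<in> carrier_mat M N" "W12 \<in> carrier_mat M N'" "W21 \<in> carrier_mat M' N" "W22 \<in> carrier_mat M' N'"
    and W_eq: "W = four_block_mat W11 W12 W21 W22"
    using split_block[OF assms(16), of M' N'] W m n by auto
  have Vb: "V11 \<in> carrier_mat M N" "V12 \<in> carrier_mat M N'" "V21 \<in> carrier_mat M' N" "V22 \<in> carrier_mat M' N'"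
    using split_block[OF assms(18), of M' N'] V m n by auto
  define B where "B = ls \<cdot>\<^sub>m A11 - \<theta> \<cdot>\<^sub>m ones_mat M N"
  have B: "B \<in> carrier_mat M N" by (simp add: B_def ones_mat_def minus_carrier_mat)
  have us: "us \<in> carrier_vec M" "us \<bullet> us = 1" and vs: "vs \<in> carrier_vec N"
    and B0: "B *\<^sub>v vs - us = 0\<^sub>v M" "transpose_mat B *\<^sub>v us - vs = 0\<^sub>v N"
    using assms(11) by (auto simp: solves_system_def B_def)
  have eq_of_diff: "x = y" if "x - y = 0\<^sub>v k" "x \<in> carrier_vec k" "y \<in> carrier_vec k" for x y :: "real vec" and k
  proof (rule eq_vecI)
    fix i assume "i < dim_vec y"
    moreover from this that have "(x - y) $ i = 0" by simp
    ultimately show "x $ i = y $ i" by simp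
  qed (use that in simp)
  have Bvs: "B *\<^sub>v vs = us" by (rule eq_of_diff[OF B0(1)]) (use B us vs in auto)
  have Bus: "transpose_mat B *\<^sub>v us = vs" by (rule eq_of_diff[OF B0(2)]) (use B us vs in auto)
  \<comment> \<open>The system normalizes only \<open>us\<close>; adjointness transfers the unit
    length to \<open>vs\<close>.\<close>
  have vs1: "vs \<bullet> vs = 1"
    using transpose_vec_mult_scalar[OF B vs us(1)] by (simp add: Bus Bvs us)
  note close = eps_solution_bounds[OF us(1) vs assms(14)]
  have n0: "0 < n" "0 < N" "0 < N + N'" using N by auto
  have nA: "0 \<le> spectral_norm A" using vec_norm_mult_mat_vec_le(1)[OF A zero_carrier_vec n0(1)] .
  have nW: "0 \<le> spectral_norm W" using vec_norm_mult_mat_vec_le(1)[OF W zero_carrier_vec n0(1)] .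
  \<comment> \<open>The slack \<open>(spectral_norm A + 7.5) * \<epsilon>\<close> below 1 covers the
    error on the complements, namely \<epsilon> times the norm of \<open>A\<close> plus the square
    of \<epsilon>.\<close>
  have "\<epsilon>\<^sup>2 \<le> 7.5 * \<epsilon>" unfolding power2_eq_square using \<epsilon> by (intro mult_right_mono) auto
  hence small: "spectral_norm W + \<epsilon> * spectral_norm A + \<epsilon>\<^sup>2 \<le> 1"
    using normW by (simp add: algebra_simps)
  have W1: "spectral_norm W \<le> 1"
  proof -
    have "0 \<le> (spectral_norm A + 7.5) * \<epsilon>" using nA \<epsilon> by simp
    thus ?thesis using normW by linarith
  qed

  \<comment> \<open>Size of the components removed by the projections\<close>
  define a where "a = transpose_mat W12 *\<^sub>v us"
  define b where "b = W21 *\<^sub>v vs"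
  have a: "a \<in> carrier_vec N'" and b: "b \<in> carrier_vec M'" using Wb us vs by (auto simp: a_def b_def)
  have unit_norm: "vec_norm (unit_vec k i) = 1" if "i < k" for k i using that by (simp add: vec_norm_def)
  \<comment> \<open>Since W12^T u = 0, the vector \<open>a\<close> is, up to sign, the image of
    \<open>u - us\<close>, and \<open>W\<close> is a contraction. Unit vectors extract the entries
    so that the block bound applies.\<close>
  have a_le: "\<bar>a $ j\<bar> \<le> \<epsilon>" if j: "j < N'" for j
  proof -
    have du: "u - us \<in> carrier_vec M" using us close by simp
    have "transpose_mat W12 *\<^sub>v (u - us) = - a"
      using Wb us close W12u a by (simp add: mult_minus_distrib_mat_vec[of _ N' M] N'_def[symmetric] a_def[symmetric])
    hence "\<bar>a $ j\<bar> = \<bar>(transpose_mat W12 *\<^sub>v (u - us)) \<bullet> unit_vec N' j\<bar>" using j a by simp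
    also have "\<dots> = \<bar>(u - us) \<bullet> (W12 *\<^sub>v unit_vec N' j)\<bar>"
      using transpose_vec_mult_scalar[OF Wb(2) unit_vec_carrier du] by simp
    also have "\<dots> \<le> spectral_norm W * (vec_norm (u - us) * vec_norm (unit_vec N' j))"
      by (rule abs_bilinear_block_le(2)[OF Wb W_eq n0(3) du zero_carrier_vec zero_carrier_vec unit_vec_carrier])
    also have "\<dots> \<le> 1 * (\<epsilon> * 1)"
      using W1 nW close unit_norm[OF j] \<epsilon> by (intro mult_mono) (auto simp: vec_norm_nonneg)
    finally show ?thesis by simp
  qed
  \<comment> \<open>The same argument with W21 v = 0 and \<open>v - vs\<close>.\<close>
  have b_le: "\<bar>b $ i\<bar> \<le> \<epsilon>" if i: "i < M'" for i
  proof -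
    have dv: "v - vs \<in> carrier_vec N" using vs close by simp
    have "W21 *\<^sub>v (v - vs) = - b"
      using Wb vs close W21v b by (simp add: mult_minus_distrib_mat_vec[of _ M' N] M'_def[symmetric] b_def[symmetric])
    hence "\<bar>b $ i\<bar> = \<bar>unit_vec M' i \<bullet> (W21 *\<^sub>v (v - vs))\<bar>" using i b by simp
    also have "\<dots> \<le> spectral_norm W * (vec_norm (unit_vec M' i) * vec_norm (v - vs))"
      by (rule abs_bilinear_block_le(3)[OF Wb W_eq n0(3) zero_carrier_vec unit_vec_carrier dv zero_carrier_vec])
    also have "\<dots> \<le> 1 * (1 * \<epsilon>)"
      using W1 nW close unit_norm[OF i] \<epsilon> by (intro mult_mono) (auto simp: vec_norm_nonneg)
    finally show ?thesis by simp
  qed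
  have us_le: "\<bar>us $ i\<bar> \<le> 1" if "i < M" for i
    using abs_entry_le_vec_norm[OF us(1) that] us by (simp add: vec_norm_def)
  have vs_le: "\<bar>vs $ j\<bar> \<le> 1" if "j < N" for j
    using abs_entry_le_vec_norm[OF vs that] vs1 by (simp add: vec_norm_def)

  \<comment> \<open>The exact certificate\<close>
  define Z where "Z = four_block_mat B (W12 - outer_prod us a) (W21 - outer_prod b vs) (W22 + (ls - l) \<cdot>\<^sub>m A22)"
  \<comment> \<open>What is subtracted from \<open>W12\<close> and \<open>W21\<close>, and the
    change of \<lambda> there, is moved into \<open>U\<close> with the factor
    \<open>inverse \<theta>\<close>. In the last block the change of \<lambda> goes into
    \<open>Z\<close> instead, because the entries of \<open>V22\<close> may already have absolute
    value 1.\<close>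
  define U where "U = four_block_mat (ones_mat M N)
    (V12 + inverse \<theta> \<cdot>\<^sub>m ((ls - l) \<cdot>\<^sub>m A12 + outer_prod us a))
    (V21 + inverse \<theta> \<cdot>\<^sub>m ((ls - l) \<cdot>\<^sub>m A21 + outer_prod b vs)) V22"
  have dims: "dim_row A11 = M" "dim_col A11 = N" "dim_row A12 = M" "dim_col A12 = N'" "dim_row A21 = M'"
    "dim_col A21 = N" "dim_row A22 = M'" "dim_col A22 = N'"
    "dim_row V12 = M" "dim_col V12 = N'" "dim_row V21 = M'"
    "dim_col V21 = N" "dim_row V22 = M'" "dim_col V22 = N'"
    "dim_vec us = M" "dim_vec vs = N" "dim_vec a = N'" "dim_vec b = M'"
    "dim_vec u = M" "dim_vec v = N"
    using Ab Vb us vs a b close by auto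
  have Z: "Z \<in> carrier_mat m n" and U: "U \<in> carrier_mat m n"
    unfolding Z_def U_def m n using B Ab Vb by (auto simp: ones_mat_def dims)
  have split: "ls \<cdot>\<^sub>m A = Z + \<theta> \<cdot>\<^sub>m U"
    by (rule eq_matI)
      (use \<theta> in \<open>auto simp: A_eq Z_def U_def B_def W12 W21 W22 ones_mat_def outer_prod_def dims field_simps\<close>)
  have contr: "\<bar>x \<bullet> (Z *\<^sub>v y)\<bar> \<le> vec_norm x * vec_norm y"
    if "x \<in> carrier_vec m" "y \<in> carrier_vec n" for x y
    unfolding Z_def a_def b_def
  proof (rule perturbed_certificate_contraction[OF Ab Wb n0(2) us vs vs1 close(1,4,2,5,3) _ Bvs Bus])
    show "B = W11 + (ls - l) \<cdot>\<^sub>m A11 + outer_prod u v"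
      by (rule eq_matI) (auto simp: B_def W11 V11 ones_mat_def outer_prod_def dims algebra_simps)
  qed (use that small in \<open>simp_all add: m n W_eq[symmetric] A_eq[symmetric]\<close>)
  have U1: "\<bar>U $$ (i, j)\<bar> \<le> 1" if ij: "i < m" "j < n" for i j
  proof -
    consider "i < M" "j < N" | "i < M" "N \<le> j" | "M \<le> i" "j < N" | "M \<le> i" "N \<le> j" by linarith
    thus ?thesis
    proof cases
      case 1
      thus ?thesis using ij by (simp add: U_def ones_mat_def dims)
    next
      case 2
      hence j: "j - N < N'" "N < n" using ij n by auto
      \<comment> \<open>Entries of a unit vector are at most 1, so the rank-one correction costs at
        most \<epsilon> per entry.\<close>
      have "\<bar>us $ i * a $ (j - N)\<bar> \<le> 1 * \<epsilon>"
        unfolding abs_mult using us_le a_le 2 j by (intro mult_mono) auto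
      moreover have "\<bar>A12 $$ (i, j - N)\<bar> \<le> entry_max_norm A12" "\<bar>V12 $$ (i, j - N)\<bar> \<le> entry_max_norm V12"
        using 2 j dims by (auto intro!: abs_entry_le_entry_max_norm)
      ultimately have "\<bar>V12 $$ (i, j - N) + inverse \<theta> * ((ls - l) * A12 $$ (i, j - N) + us $ i * a $ (j - N))\<bar> \<le> 1"
        using V12[OF j(2)] close(3) by (intro abs_perturbed_entry_le[OF \<theta>]) auto
      thus ?thesis using 2 j by (simp add: U_def ones_mat_def outer_prod_def dims)
    next
      case 3
      hence i: "i - M < M'" "M < m" using ij m by auto
      have "\<bar>b $ (i - M) * vs $ j\<bar> \<le> \<epsilon> * 1"
        unfolding abs_mult using vs_le b_le 3 i \<epsilon> by (intro mult_mono) auto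
      moreover have "\<bar>A21 $$ (i - M, j)\<bar> \<le> entry_max_norm A21" "\<bar>V21 $$ (i - M, j)\<bar> \<le> entry_max_norm V21"
        using 3 i dims by (auto intro!: abs_entry_le_entry_max_norm)
      ultimately have "\<bar>V21 $$ (i - M, j) + inverse \<theta> * ((ls - l) * A21 $$ (i - M, j) + b $ (i - M) * vs $ j)\<bar> \<le> 1"
        using V21[OF i(2)] close(3) by (intro abs_perturbed_entry_le[OF \<theta>]) auto
      thus ?thesis using 3 i by (simp add: U_def ones_mat_def outer_prod_def dims)
    next
      case 4
      hence "\<bar>V22 $$ (i - M, j - N)\<bar> \<le> entry_max_norm V22" "M < m" "N < n"
        using ij m n dims by (auto intro!: abs_entry_le_entry_max_norm)
      thus ?thesis using 4 ij m n V22 by (simp add: U_def ones_mat_def dims)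
    qed
  qed

  \<comment> \<open>The rank-one candidate and its objective value\<close>
  define c where "c = us @\<^sub>v 0\<^sub>v M'"
  define d where "d = vs @\<^sub>v 0\<^sub>v N'"
  have c: "c \<in> carrier_vec m" "c \<bullet> c = 1" and d: "d \<in> carrier_vec n" "d \<bullet> d = 1"
    using us vs vs1 by (auto simp: c_def d_def m n scalar_prod_append[of _ M _ M'] scalar_prod_append[of _ N _ N'])
  have c0: "0\<^sub>v m \<le> c" and d0: "0\<^sub>v n \<le> d"
    using us0 vs0 by (auto simp: less_eq_vec_def c_def d_def m n dims)
  have X_eq: "rank_one_block m n s us vs = s \<cdot>\<^sub>m outer_prod c d" for s
    unfolding c_def d_def M'_def N'_def by (rule rank_one_block_eq_outer_prod[OF us(1) vs M(2) N(2)])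
  \<comment> \<open>As \<open>c\<close> and \<open>d\<close> are nonnegative, \<open>S\<close> is
    the entry sum norm of their outer product.\<close>
  define S where "S = (\<Sum>i<m. c $ i) * (\<Sum>j<n. d $ j)"
  have S: "0 \<le> S"
    unfolding S_def using c0 d0 by (intro mult_nonneg_nonneg sum_nonneg) (auto simp: less_eq_vec_def)
  define t where "t = c \<bullet> (A *\<^sub>v d)"
  \<comment> \<open>Pairing \<open>B *\<^sub>v vs = us\<close> with \<open>us\<close> gives 1 on one
    side and \<open>ls * t - \<theta> * S\<close> on the other.\<close>
  have lt: "ls * t = 1 + \<theta> * S"
  proof -
    have "A12 *\<^sub>v 0\<^sub>v N' = 0\<^sub>v M" using mult_mat_zero_vec[of A12] by (simp add: dims)
    hence t_eq: "t = us \<bullet> (A11 *\<^sub>v vs)"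
      unfolding t_def c_def d_def A_eq
        four_block_bilinear[OF Ab us(1) zero_carrier_vec vs zero_carrier_vec]
      using Ab us vs by simp
    have "1 = us \<bullet> (B *\<^sub>v vs)" by (simp add: Bvs us)
    also have "B *\<^sub>v vs = ls \<cdot>\<^sub>v (A11 *\<^sub>v vs) - \<theta> \<cdot>\<^sub>v (ones_mat M N *\<^sub>v vs)"
      unfolding B_def using Ab vs
      by (simp add: minus_mult_distrib_mat_vec[of _ M N] smult_mat_mult_vec[of _ M N] ones_mat_def)
    also have "us \<bullet> \<dots> = ls * t - \<theta> * (us \<bullet> (ones_mat M N *\<^sub>v vs))"
    proof -
      have "A11 *\<^sub>v vs \<in> carrier_vec M" "ones_mat M N *\<^sub>v vs \<in> carrier_vec M"
        using mult_mat_vec_carrier[OF Ab(1) vs] mult_mat_vec_carrier[OF _ vs, of "ones_mat M N" M]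
        by (simp_all add: ones_mat_def)
      thus ?thesis using us by (simp add: t_eq scalar_prod_minus_distrib[of _ M])
    qed
    also have "us \<bullet> (ones_mat M N *\<^sub>v vs) = (\<Sum>i<M. us $ i) * (\<Sum>j<N. vs $ j)"
      by (simp add: scalar_prod_def ones_mat_def dims atLeast0LessThan sum_distrib_right)
    also have "(\<Sum>i<M. us $ i) = (\<Sum>i<m. c $ i)"
      by (rule sum.mono_neutral_cong_left) (auto simp: c_def m dims)
    also have "(\<Sum>j<N. vs $ j) = (\<Sum>j<n. d $ j)"
      by (rule sum.mono_neutral_cong_left) (auto simp: d_def n dims)
    finally show ?thesis by (simp add: S_def)
  qed
  \<comment> \<open>Positivity makes \<open>t\<close> nonzero, so the constraint can be met, and
    gives \<open>ls\<close> and \<open>t\<close> the same sign.\<close>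
  have lt_pos: "0 < ls * t" using S \<theta> by (simp add: lt add_pos_nonneg)
  hence t: "t \<noteq> 0" by auto
  have inner: "mat_inner A (rank_one_block m n s us vs) = s * t" for s
    unfolding X_eq t_def by (rule mat_inner_outer_prod[OF A c(1) d(1)])
  define \<sigma> where "\<sigma> = 1 / t"
  have feas: "feasible A (rank_one_block m n \<sigma> us vs)"
    using A c d t inner[of \<sigma>] by (simp add: feasible_def X_eq \<sigma>_def)
  have "objective \<theta> (rank_one_block m n \<sigma> us vs) \<le> \<bar>\<sigma>\<bar> + \<theta> * (\<bar>\<sigma>\<bar> * S)"
    unfolding objective_def X_eq entry_sum_norm_outer_prod[OF c(1) c0 d(1) d0] S_def
    using nuclear_norm_rank_one_le[OF c d] by simp
  \<comment> \<open>The factor \<open>1 + \<theta> * S\<close> is \<open>ls * t\<close>, and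
    \<open>\<sigma>\<close> cancels \<open>t\<close>: the objective meets the dual bound.\<close>
  also have "\<dots> = \<bar>\<sigma>\<bar> * \<bar>ls * t\<bar>" using lt_pos by (simp add: lt algebra_simps)
  also have "\<dots> = \<bar>ls\<bar>" using t by (simp add: \<sigma>_def abs_mult)
  finally have obj: "objective \<theta> (rank_one_block m n \<sigma> us vs) \<le> \<bar>ls\<bar>" .
  have "optimal_solution A \<theta> (rank_one_block m n \<sigma> us vs)"
    using \<theta> by (intro optimal_from_dual_certificate[OF A Z U _ split contr U1 feas obj]) auto
  moreover have "vec_space.rank m (rank_one_block m n \<sigma> us vs) = 1"
  proof -
    have "\<sigma> \<noteq> 0" using t by (simp add: \<sigma>_def)
    \<comment> \<open>The scalar is absorbed into the left vector, which stays nonzero since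
      \<sigma> is nonzero.\<close>
    have "\<sigma> \<cdot>\<^sub>m outer_prod c d = outer_prod (\<sigma> \<cdot>\<^sub>v c) d"
      by (rule eq_matI) (auto simp: outer_prod_def)
    moreover have "vec_space.rank m (outer_prod (\<sigma> \<cdot>\<^sub>v c) d) = 1"
    proof (rule rank_outer_prod)
      show "\<sigma> \<cdot>\<^sub>v c \<noteq> 0\<^sub>v m"
      proof
        assume "\<sigma> \<cdot>\<^sub>v c = 0\<^sub>v m"
        hence "(\<sigma> \<cdot>\<^sub>v c) \<bullet> c = 0" using c by simp
        thus False using c \<open>\<sigma> \<noteq> 0\<close> by simp
      qed
      show "d \<noteq> 0\<^sub>v n" using d by auto
    qed (use c d in auto)
    ultimately show ?thesis by (simp add: X_eq)
  qed
  moreover have "\<forall>s. mat_inner A (rank_one_block m n s us vs) = 1 \<longleftrightarrow> s = \<sigma>"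
    using t by (auto simp: inner \<sigma>_def field_simps)
  ultimately show ?thesis by blast
qed

end
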